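(* Let $X$ be a compact convex set and let $H$ be an intermediate function space on $X$ which is determined by extreme points and satisfies $H^\mu=H$. Then the following assertions hold. (i) The systems $$\mathcal A_H=\{E\subset \operatorname{ext} X : \exists m\in M(H)\colon m|_E=1 \text{ and } m|_{\operatorname{ext} X\setminus E}=0\}$$ and $$\mathcal A_H^s=\{E\subset \operatorname{ext} X : \exists m\in M^s(H)\colon m|_E=1 \text{ and } m|_{\operatorname{ext} X\setminus E}=0\}$$ are $\sigma$-algebras (on $\operatorname{ext}X$). (ii) Let $u\in\ell^\infty(\operatorname{ext} X)$. Then $u$ may be extended to an element of $M(H)$ if and only if $u$ is $\mathcal A_H$-measurable, and $u$ may be extended to an element of $M^s(H)$ if and only if $u$ is $\mathcal A_H^s$-measurable. (iii) For any $x\in X$ there is a unique probability measure $\mu=\mu_{H,x}$ on $(\operatorname{ext}X,\mathcal A_H)$ such that $$\forall m\in M(H)\colon\quad m(x)=\int_{\operatorname{ext}X} m\,d\mu .$$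
   Context: A compact convex set is a compact convex subset of a (Hausdorff) locally convex real topological vector space; $\operatorname{ext}X$ is the set of its extreme points. $A_c(X)$ is the space of continuous affine real functions on $X$ and $A_b(X)$ the space of bounded affine real functions on $X$ with the supremum norm. An intermediate function space on $X$ is a (norm-)closed linear subspace $H\subset A_b(X)$ with $A_c(X)\subset H$. It is determined by extreme points if $\inf u(\operatorname{ext}X)\le u\le\sup u(\operatorname{ext}X)$ for every $u\in H$. For a family $F$ of bounded functions on $X$, $F^\mu$ is the smallest family of functions on $X$ containing $F$ and closed with respect to pointwise limits of monotone bounded sequences. $\ell^\infty(\operatorname{ext}X)$ is the space of all bounded real functions on $\operatorname{ext}X$. $M_1(X)$ is the set of (complete) Radon probability measures on $X$. For $\mu,\nu\in M_1(X)$, $\mu\prec\nu$ means $\int f\,d\mu\le\int f\,d\nu$ for every convex continuous $f:X\to\mathbb R$; $\mu\in M_1(X)$ is maximal if it is maximal with respect to $\prec$. Multipliers: $M(H)=\{u\in H:\forall a\in H\ \exists b\in H\colon b=u\cdot a\text{ on }\operatorname{ext}X\}$. Strong multipliers: $M^s(H)=\{u\in H:\forall a\in H\ \exists b\in H\colon b=u\cdot a\ \mu\text{-almost everywhere for each maximal }\mu\in M_1(X)\}$. *)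

theory Defs
  imports "HOL-Analysis.Analysis" "HOL-Probability.Probability"
begin

section \<open>Hausdorff locally convex real topological vector spaces\<close>

class locally_convex_space = real_vector + topological_ab_group_add + t2_space +
  assumes tendsto_scaleR_nhds:
      "((\<lambda>p. fst p *\<^sub>R snd p) \<longlongrightarrow> c *\<^sub>R x) (nhds c \<times>\<^sub>F nhds x)"
    and locally_convex:
      "open U \<Longrightarrow> 0 \<in> U \<Longrightarrow> \<exists>V. open V \<and> 0 \<in> V \<and> V \<subseteq> U \<and>
         (\<forall>x\<in>V. \<forall>y\<in>V. \<forall>u\<ge>0. \<forall>v\<ge>0. u + v = 1 \<longrightarrow> u *\<^sub>R x + v *\<^sub>R y \<in> V)"

text \<open>The last conjunct is \<^term>\<open>convex V\<close>; the constant itself cannot occur in a class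
  specification.\<close>

instance real_normed_vector \<subseteq> locally_convex_space
proof
  fix c :: real and x :: 'a
  show "((\<lambda>p. fst p *\<^sub>R snd p) \<longlongrightarrow> c *\<^sub>R x) (nhds c \<times>\<^sub>F nhds x)"
    by (intro tendsto_scaleR filterlim_fst filterlim_snd)
next
  fix U :: "'a set"
  assume "open U" "0 \<in> U"
  then obtain e where "e > 0" "ball 0 e \<subseteq> U"
    using open_contains_ball by blast
  moreover have "convex (ball (0::'a) e)"
    by (rule convex_ball)
  ultimately show "\<exists>V. open V \<and> 0 \<in> V \<and> V \<subseteq> U \<and>
      (\<forall>x\<in>V. \<forall>y\<in>V. \<forall>u\<ge>0. \<forall>v\<ge>0. u + v = 1 \<longrightarrow> u *\<^sub>R x + v *\<^sub>R y \<in> V)"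
    unfolding convex_def by (intro exI[of _ "ball 0 e"]) auto
qed

definition compact_convex_set :: "'a::locally_convex_space set \<Rightarrow> bool" where
  "compact_convex_set X \<longleftrightarrow> compact X \<and> convex X"

definition ext :: "'a::real_vector set \<Rightarrow> 'a set" where
  "ext X = {x. x extreme_point_of X}"


section \<open>Function spaces\<close>

text \<open>Real functions on \<open>X\<close> are represented by functions in \<^term>\<open>extensional X\<close>, so that
  equality of functions means equality on \<open>X\<close>.\<close>

definition affine_fun_on :: "'a::real_vector set \<Rightarrow> ('a \<Rightarrow> real) \<Rightarrow> bool" where
  "affine_fun_on X f \<longleftrightarrow>
     (\<forall>x\<in>X. \<forall>y\<in>X. \<forall>t\<in>{0..1}. f ((1 - t) *\<^sub>R x + t *\<^sub>R y) = (1 - t) * f x + t * f y)"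

definition A_c :: "'a::locally_convex_space set \<Rightarrow> ('a \<Rightarrow> real) set" where
  "A_c X = {f \<in> extensional X. affine_fun_on X f \<and> continuous_on X f}"

definition A_b :: "'a::locally_convex_space set \<Rightarrow> ('a \<Rightarrow> real) set" where
  "A_b X = {f \<in> extensional X. affine_fun_on X f \<and> bounded (f ` X)}"

definition sup_norm :: "'a set \<Rightarrow> ('a \<Rightarrow> real) \<Rightarrow> real" where
  "sup_norm X f = (SUP x\<in>X. \<bar>f x\<bar>)"

definition linear_subspace_on :: "'a set \<Rightarrow> ('a \<Rightarrow> real) set \<Rightarrow> bool" where
  "linear_subspace_on X H \<longleftrightarrow>
     (\<lambda>x\<in>X. 0) \<in> H \<and>
     (\<forall>f\<in>H. \<forall>g\<in>H. (\<lambda>x\<in>X. f x + g x) \<in> H) \<and>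
     (\<forall>c. \<forall>f\<in>H. (\<lambda>x\<in>X. c * f x) \<in> H)"

definition norm_closed_in_A_b :: "'a::locally_convex_space set \<Rightarrow> ('a \<Rightarrow> real) set \<Rightarrow> bool" where
  "norm_closed_in_A_b X H \<longleftrightarrow>
     (\<forall>f\<in>A_b X. (\<forall>e>0. \<exists>h\<in>H. sup_norm X (\<lambda>x. f x - h x) < e) \<longrightarrow> f \<in> H)"

definition intermediate_function_space ::
    "'a::locally_convex_space set \<Rightarrow> ('a \<Rightarrow> real) set \<Rightarrow> bool" where
  "intermediate_function_space X H \<longleftrightarrow>
     H \<subseteq> A_b X \<and> linear_subspace_on X H \<and> norm_closed_in_A_b X H \<and> A_c X \<subseteq> H"

definition determined_by_extreme_points ::
    "'a::locally_convex_space set \<Rightarrow> ('a \<Rightarrow> real) set \<Rightarrow> bool" where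
  "determined_by_extreme_points X H \<longleftrightarrow>
     (\<forall>u\<in>H. \<forall>x\<in>X. Inf (u ` ext X) \<le> u x \<and> u x \<le> Sup (u ` ext X))"

text \<open>The family \<open>F\<^sup>\<mu>\<close>. A sequence of functions is bounded if it is bounded in the supremum norm.\<close>

inductive_set monotone_closure :: "'a set \<Rightarrow> ('a \<Rightarrow> real) set \<Rightarrow> ('a \<Rightarrow> real) set"
  for X :: "'a set" and F :: "('a \<Rightarrow> real) set" where
    base: "f \<in> F \<Longrightarrow> f \<in> monotone_closure X F"
  | limit: "f \<in> monotone_closure X F"
      if "\<And>n. s n \<in> monotone_closure X F"
        and "(\<forall>x\<in>X. incseq (\<lambda>n. s n x)) \<or> (\<forall>x\<in>X. decseq (\<lambda>n. s n x))"
        and "\<forall>n. \<forall>x\<in>X. \<bar>s n x\<bar> \<le> C"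
        and "f \<in> extensional X"
        and "\<forall>x\<in>X. (\<lambda>n. s n x) \<longlonglongrightarrow> f x"
      for s :: "nat \<Rightarrow> 'a \<Rightarrow> real" and f :: "'a \<Rightarrow> real" and C :: real


section \<open>Radon probability measures and the Choquet order\<close>

definition M_1 :: "'a::locally_convex_space set \<Rightarrow> 'a measure set" where
  "M_1 X = {completion \<nu> | \<nu>. prob_space \<nu> \<and> sets \<nu> = sets (restrict_space borel X) \<and>
     (\<forall>B\<in>sets \<nu>. emeasure \<nu> B = (SUP K\<in>{K. K \<subseteq> B \<and> compact K}. emeasure \<nu> K))}"

definition choquet_le :: "'a::locally_convex_space set \<Rightarrow> 'a measure \<Rightarrow> 'a measure \<Rightarrow> bool" where
  "choquet_le X \<mu> \<nu> \<longleftrightarrow>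
     (\<forall>f. convex_on X f \<and> continuous_on X f \<longrightarrow> (\<integral>x. f x \<partial>\<mu>) \<le> (\<integral>x. f x \<partial>\<nu>))"

definition maximal_measure :: "'a::locally_convex_space set \<Rightarrow> 'a measure \<Rightarrow> bool" where
  "maximal_measure X \<mu> \<longleftrightarrow>
     \<mu> \<in> M_1 X \<and> (\<forall>\<nu>\<in>M_1 X. choquet_le X \<mu> \<nu> \<longrightarrow> \<nu> = \<mu>)"


section \<open>Multipliers\<close>

definition multipliers ::
    "'a::locally_convex_space set \<Rightarrow> ('a \<Rightarrow> real) set \<Rightarrow> ('a \<Rightarrow> real) set" where
  "multipliers X H = {u \<in> H. \<forall>a\<in>H. \<exists>b\<in>H. \<forall>x\<in>ext X. b x = u x * a x}"

definition strong_multipliers ::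
    "'a::locally_convex_space set \<Rightarrow> ('a \<Rightarrow> real) set \<Rightarrow> ('a \<Rightarrow> real) set" where
  "strong_multipliers X H =
     {u \<in> H. \<forall>a\<in>H. \<exists>b\<in>H. \<forall>\<mu>. maximal_measure X \<mu> \<longrightarrow> (AE x in \<mu>. b x = u x * a x)}"

text \<open>The systems \<open>\<A>\<^sub>H\<close> and \<open>\<A>\<^sub>H\<^sup>s\<close> are obtained for \<open>\<M>\<close> the multipliers and the strong
  multipliers of \<open>H\<close>, respectively.\<close>

definition indicator_system :: "'a::locally_convex_space set \<Rightarrow> ('a \<Rightarrow> real) set \<Rightarrow> 'a set set" where
  "indicator_system X \<M> =
     {E. E \<subseteq> ext X \<and> (\<exists>m\<in>\<M>. (\<forall>x\<in>E. m x = 1) \<and> (\<forall>x\<in>ext X - E. m x = 0))}"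

abbreviation mult_algebra :: "'a::locally_convex_space set \<Rightarrow> ('a \<Rightarrow> real) set \<Rightarrow> 'a set set" where
  "mult_algebra X H \<equiv> indicator_system X (multipliers X H)"

abbreviation strong_mult_algebra ::
    "'a::locally_convex_space set \<Rightarrow> ('a \<Rightarrow> real) set \<Rightarrow> 'a set set" where
  "strong_mult_algebra X H \<equiv> indicator_system X (strong_multipliers X H)"

definition extends_to :: "'a::locally_convex_space set \<Rightarrow> ('a \<Rightarrow> real) \<Rightarrow> ('a \<Rightarrow> real) set \<Rightarrow> bool" where
  "extends_to X u \<M> \<longleftrightarrow> (\<exists>m\<in>\<M>. \<forall>x\<in>ext X. m x = u x)"

end

theory Submission
  imports Defs
begin

text \<open>
  Restricted to \<open>ext X\<close>, the multipliers form an algebra of bounded functions containing the constants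
  and closed under limits of bounded increasing sequences: since \<open>H\<close> is determined by extreme points,
  monotonicity on \<open>ext X\<close> passes to \<open>X\<close>, and \<open>H\<^sup>\<mu> = H\<close> then provides the limit. By Weierstrass'
  theorem such an algebra is closed under composition with continuous functions, so it consists
  exactly of the bounded functions measurable with respect to the sets whose indicators it contains,
  and evaluation at \<open>x\<close> is integration against a measure, as in Daniell's construction.

  For strong multipliers one must know that an identity holding almost everywhere for all maximal
  measures holds on \<open>ext X\<close>, that is, that the Dirac measure at an extreme point is maximal. If
  \<open>\<nu>\<close> dominates it and \<open>C \<subseteq> X\<close> is compact convex with \<open>x \<notin> C\<close>, then for every \<open>\<epsilon> > 0\<close> there is a
  convex continuous function with values in \<open>[-1, 0]\<close> which is \<open>-1\<close> on \<open>C\<close> and at least \<open>-\<epsilon>\<close> at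
  \<open>x\<close>, whence \<open>\<nu> C \<le> \<epsilon>\<close>. Finitely many such sets cover any compact subset of \<open>X - {x}\<close>.
\<close>

section \<open>Algebras of bounded functions closed under monotone limits\<close>

locale bounded_monotone_algebra =
  fixes S :: "'a set" and P :: "('a \<Rightarrow> real) \<Rightarrow> bool"
  assumes cong: "P f \<Longrightarrow> (\<And>x. x \<in> S \<Longrightarrow> g x = f x) \<Longrightarrow> P g"
    and const: "P (\<lambda>_. c)"
    and add: "P f \<Longrightarrow> P g \<Longrightarrow> P (\<lambda>x. f x + g x)"
    and mult: "P f \<Longrightarrow> P g \<Longrightarrow> P (\<lambda>x. f x * g x)"
    and bounded: "P f \<Longrightarrow> bounded (f ` S)"
    and incseq_limit: "(\<And>n. P (s n)) \<Longrightarrow> (\<And>x. x \<in> S \<Longrightarrow> incseq (\<lambda>n. s n x)) \<Longrightarrow>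
      (\<And>x. x \<in> S \<Longrightarrow> (\<lambda>n. s n x) \<longlonglongrightarrow> f x) \<Longrightarrow> bounded (f ` S) \<Longrightarrow> P f"
begin

definition indicator_sets :: "'a set set" where
  "indicator_sets = {E. E \<subseteq> S \<and> P (indicator E)}"

lemma cmult: "P f \<Longrightarrow> P (\<lambda>x. c * f x)"
  using mult[OF const] .

lemma diff: "P f \<Longrightarrow> P g \<Longrightarrow> P (\<lambda>x. f x - g x)"
  using add[OF _ cmult[of g "-1"], of f] by simp

lemma indicator_Un: "P (indicator A) \<Longrightarrow> P (indicator B) \<Longrightarrow> P (indicator (A \<union> B))"
proof -
  assume "P (indicator A)" "P (indicator B)"
  then have "P (\<lambda>x. indicator A x + indicator B x - indicator A x * indicator B x)"
    by (intro diff add mult)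
  then show ?thesis by (rule cong) (auto simp: indicator_def)
qed

text \<open>Complements correspond to \<open>1 - f\<close>, finite unions to
  \<open>f + g - f * g\<close>, and a countable union is the increasing limit of its finite partial
  unions.\<close>

lemma sigma_algebra_indicator_sets: "sigma_algebra S indicator_sets"
  unfolding sigma_algebra_iff2
proof (intro conjI ballI allI impI)
  show "indicator_sets \<subseteq> Pow S" by (auto simp: indicator_sets_def)
  show "{} \<in> indicator_sets"
    using cong[OF const[of 0], of "indicator {}"] by (simp add: indicator_sets_def)
next
  fix E assume "E \<in> indicator_sets"
  then have "P (\<lambda>x. 1 - indicator E x)" "E \<subseteq> S"
    by (auto simp: indicator_sets_def intro: diff const)
  then show "S - E \<in> indicator_sets"
    by (auto simp: indicator_sets_def elim!: cong split: split_indicator)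
next
  fix A :: "nat \<Rightarrow> 'a set" assume A: "range A \<subseteq> indicator_sets"
  have "P (indicator (\<Union>i<n. A i))" for n
  proof (induction n)
    case 0
    show ?case by (rule cong[OF const[of 0]]) simp
  next
    case (Suc n)
    have "P (indicator (A n))" using A by (auto simp: indicator_sets_def)
    then show ?case using indicator_Un[OF _ Suc] by (simp add: lessThan_Suc)
  qed
  moreover have "incseq (\<lambda>n. indicator (\<Union>i<n. A i) x :: real)" for x
    by (intro incseq_SucI indicator_leI) (auto simp: less_Suc_eq)
  ultimately have "P (indicator (\<Union>i. A i))"
    by (rule incseq_limit)
      (auto simp: LIMSEQ_indicator_UN intro!: boundedI[of _ 1] split: split_indicator)
  then show "(\<Union>i. A i) \<in> indicator_sets"
    using A by (auto simp: indicator_sets_def)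
qed

lemma space_indicator_sets [simp]: "space (sigma S indicator_sets) = S"
  and sets_indicator_sets [simp]: "sets (sigma S indicator_sets) = indicator_sets"
  using sigma_algebra_indicator_sets
  by (simp_all add: sigma_algebra.space_measure_of_eq sigma_algebra.sets_measure_of_eq)

section \<open>Functional calculus and measurability\<close>

lemma polynomial:
  fixes p :: "real \<Rightarrow> real"
  assumes "real_polynomial_function p" "P f"
  shows "P (\<lambda>x. p (f x))"
  using assms
proof (induction rule: real_polynomial_function.induct)
  case (linear p)
  \<comment> \<open>A linear map of the reals is multiplication by its value at 1.\<close>
  then have p: "p t = p 1 * t" for t
    using linear_scale[of p t 1] by (simp add: bounded_linear.linear)
  show ?case by (rule cong[OF cmult[OF \<open>P f\<close>, of "p 1"]]) (rule p)
qed (auto intro: const add mult)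

text \<open>Approximating \<open>\<phi> - 3 / 2\<^sup>n\<close> within \<open>1 / 2\<^sup>n\<close> makes the Weierstrass polynomials an increasing
  sequence, so that closedness under monotone limits replaces uniform closedness.\<close>

lemma continuous_compose:
  fixes \<phi> :: "real \<Rightarrow> real"
  assumes \<phi>: "continuous_on UNIV \<phi>" and f: "P f"
  shows "P (\<lambda>x. \<phi> (f x))"
proof -
  from bounded[OF f] obtain C where C: "\<And>x. x \<in> S \<Longrightarrow> f x \<in> {-C..C}"
    by (auto simp: bounded_iff abs_le_iff minus_le_iff)
  have cont: "continuous_on {-C..C} (\<lambda>t. \<phi> t - 3 / 2 ^ n)" for n :: nat
    by (intro continuous_intros continuous_on_subset[OF \<phi>]) auto
  have "\<exists>p. real_polynomial_function p \<and> (\<forall>t\<in>{-C..C}. \<bar>\<phi> t - 3 / 2 ^ n - p t\<bar> < 1 / 2 ^ n)" for n :: nat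
    using Stone_Weierstrass_real_polynomial_function[OF compact_Icc cont, of "1 / 2 ^ n"]
    by (metis zero_less_divide_1_iff zero_less_numeral zero_less_power)
  then obtain p where p: "\<And>n::nat. real_polynomial_function (p n)"
    "\<And>n t. t \<in> {-C..C} \<Longrightarrow> \<bar>\<phi> t - 3 / 2 ^ n - p n t\<bar> < 1 / 2 ^ n" by metis
  show ?thesis
  proof (rule incseq_limit)
    show "P (\<lambda>x. p n (f x))" for n by (rule polynomial[OF p(1) f])
  next
    fix x assume x: "x \<in> S"
    show "incseq (\<lambda>n. p n (f x))"
    proof (rule incseq_SucI)
      fix n
      \<comment> \<open>The error bounds put \<open>p n\<close> below
        \<open>\<phi> - 2 / 2 ^ n\<close> and \<open>p (Suc n)\<close> above
        \<open>\<phi> - 4 / 2 ^ Suc n\<close>, which are the same number.\<close>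
      have "(2::real) / 2 ^ n = 4 / 2 ^ Suc n" by simp
      then show "p n (f x) \<le> p (Suc n) (f x)"
        using p(2)[OF C[OF x], of n] p(2)[OF C[OF x], of "Suc n"] by simp
    qed
    have "(\<lambda>n. 4 * (1 / 2) ^ n) \<longlonglongrightarrow> (0::real)"
      by (intro tendsto_mult_right_zero LIMSEQ_realpow_zero) auto
    then have "(\<lambda>n. p n (f x) - \<phi> (f x)) \<longlonglongrightarrow> 0"
    proof (rule Lim_null_comparison[rotated], intro always_eventually allI)
      fix n show "norm (p n (f x) - \<phi> (f x)) \<le> 4 * (1 / 2) ^ n"
        using p(2)[OF C[OF x], of n] by (simp add: power_one_over)
    qed
    then show "(\<lambda>n. p n (f x)) \<longlonglongrightarrow> \<phi> (f x)" by (rule LIM_zero_cancel)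
  next
    have "compact (\<phi> ` {-C..C})"
      by (intro compact_continuous_image continuous_on_subset[OF \<phi>]) auto
    then show "bounded ((\<lambda>x. \<phi> (f x)) ` S)"
      by (rule bounded_subset[OF compact_imp_bounded]) (use C in auto)
  qed
qed

text \<open>The functions \<open>min 1 (n * max 0 (f - c))\<close> are continuous in
  \<open>f\<close> and increase to the indicator of the set where \<open>f > c\<close>; such sets
  suffice for Borel measurability.\<close>

lemma measurable:
  assumes f: "P f"
  shows "f \<in> borel_measurable (sigma S indicator_sets)"
proof (rule borel_measurableI_greater)
  fix c
  define s where "s n x = min 1 (real n * max 0 (f x - c))" for n x
  have s: "P (s n)" for n
    unfolding s_def
    by (rule continuous_compose[OF _ f, of "\<lambda>t. min 1 (real n * max 0 (t - c))"])
      (intro continuous_intros)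
  have "P (indicator {x \<in> S. c < f x})"
  proof (rule incseq_limit[OF s])
    fix x assume "x \<in> S"
    show "incseq (\<lambda>n. s n x)"
      unfolding s_def by (intro incseq_SucI min.mono mult_right_mono) auto
    show "(\<lambda>n. s n x) \<longlonglongrightarrow> indicator {x \<in> S. c < f x} x"
    proof (cases "c < f x")
      case True
      then obtain k where k: "1 < real k * (f x - c)"
        using reals_Archimedean3[of "f x - c"] by auto
      have "s n x = 1" if "n \<ge> k" for n
      proof -
        have "real k * (f x - c) \<le> real n * (f x - c)"
          using that True by (intro mult_right_mono) auto
        with k have "1 \<le> real n * (f x - c)" by linarith
        with True show ?thesis by (simp add: s_def max_def)
      qed
      then have "eventually (\<lambda>n. s n x = 1) sequentially"
        by (auto simp: eventually_sequentially)
      with True \<open>x \<in> S\<close> show ?thesis by (simp add: tendsto_eventually)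
    qed (simp add: s_def max_def)
  qed (auto intro!: boundedI[of _ 1] split: split_indicator)
  then have "{x \<in> S. c < f x} \<in> indicator_sets" by (auto simp: indicator_sets_def)
  then show "{x \<in> space (sigma S indicator_sets). c < f x} \<in> sets (sigma S indicator_sets)" by simp
qed

lemma bounded_nonneg_le:
  fixes f g :: "'a \<Rightarrow> real"
  assumes "bounded (f ` S)" "\<And>x. x \<in> S \<Longrightarrow> 0 \<le> g x" "\<And>x. x \<in> S \<Longrightarrow> g x \<le> f x"
  shows "bounded (g ` S)"
proof -
  from assms(1) obtain C where "\<And>x. x \<in> S \<Longrightarrow> \<bar>f x\<bar> \<le> C" by (auto simp: bounded_iff)
  then have "\<bar>g x\<bar> \<le> C" if "x \<in> S" for x
    using assms(2,3)[OF that] that by force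
  then show ?thesis by (intro boundedI[of _ C]) auto
qed

lemma measurable_nonneg_imp:
  assumes "f \<in> borel_measurable (sigma S indicator_sets)" "\<And>x. 0 \<le> f x" "bounded (f ` S)"
  shows "P f"
proof -
  \<comment> \<open>Boundedness goes into the induction claim: by nonnegativity it descends from a
    sum or an increasing limit to the constituents, so the induction hypotheses apply to
    them.\<close>
  have "bounded (f ` S) \<longrightarrow> P f"
    using assms(1,2)
  proof (induction rule: borel_measurable_induct_real)
    case (set A)
    then have "A \<in> indicator_sets" by simp
    then show ?case by (simp add: indicator_sets_def)
  next
    case (mult u c)
    show ?case
    proof (cases "c = 0")
      case False
      then have "u ` S = (\<lambda>t. inverse c *\<^sub>R t) ` (\<lambda>x. c * u x) ` S"
        by (simp add: image_image field_simps)
      then have "bounded ((\<lambda>x. c * u x) ` S) \<Longrightarrow> bounded (u ` S)"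
        by (simp only: bounded_scaling)
      with mult.IH show ?thesis by (auto intro: cmult)
    qed (simp add: const)
  next
    case (add u v)
    show ?case
    proof
      assume "bounded ((\<lambda>x. v x + u x) ` S)"
      then have "bounded (v ` S)" "bounded (u ` S)"
        using add.hyps by (auto elim: bounded_nonneg_le)
      with add.IH show "P (\<lambda>x. v x + u x)"
        by (simp add: bounded_monotone_algebra.add[OF bounded_monotone_algebra_axioms])
    qed
  next
    case (seq U)
    show ?case
    proof (rule impI, rule incseq_limit[of U])
      assume "bounded (f ` S)"
      have inc: "incseq (\<lambda>n. U n x)" for x
        using \<open>incseq U\<close> by (simp add: incseq_def le_fun_def)
      show "P (U n)" for n
      proof -
        have "U n x \<le> f x" if "x \<in> S" for x
          by (rule incseq_le[OF inc]) (simp add: seq.hyps(4) that)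
        then have "bounded (U n ` S)"
          using bounded_nonneg_le[OF \<open>bounded (f ` S)\<close>] seq.hyps(2) by blast
        with seq.IH show ?thesis by blast
      qed
      show "incseq (\<lambda>n. U n x)" for x by (rule inc)
    qed (simp_all add: seq.hyps(4))
  qed
  with assms(3) show ?thesis by blast
qed

lemma iff_measurable:
  "P f \<longleftrightarrow> bounded (f ` S) \<and> f \<in> borel_measurable (sigma S indicator_sets)"
proof (intro iffI conjI; (elim conjE)?)
  assume bdd: "bounded (f ` S)" and f: "f \<in> borel_measurable (sigma S indicator_sets)"
  then obtain C where C: "\<And>x. x \<in> S \<Longrightarrow> \<bar>f x\<bar> \<le> C" by (auto simp: bounded_iff)
  \<comment> \<open>The induction asks for nonnegativity everywhere, also off \<open>S\<close>; the
    truncation provides it and leaves \<open>f + C\<close> unchanged on \<open>S\<close>.\<close>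
  define g where "g x = max 0 (f x + C)" for x
  have "g x = f x + C" if "x \<in> S" for x using C[OF that] by (simp add: g_def)
  moreover have "P g"
  proof (rule measurable_nonneg_imp)
    show "g \<in> borel_measurable (sigma S indicator_sets)"
      unfolding g_def using f by measurable
    show "bounded (g ` S)"
      using C by (auto simp: g_def bounded_iff intro!: exI[of _ "2 * C"]) (smt (verit))+
  qed (simp add: g_def)
  ultimately show "P f"
    by (intro cong[OF diff[OF \<open>P g\<close> const[of C]]]) simp
qed (auto intro: bounded measurable)

end

section \<open>Representation of a monotone expectation by a measure\<close>

locale monotone_expectation = bounded_monotone_algebra +
  fixes L :: "('a \<Rightarrow> real) \<Rightarrow> real"
  assumes L_cong: "P f \<Longrightarrow> (\<And>x. x \<in> S \<Longrightarrow> g x = f x) \<Longrightarrow> L g = L f"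
    and L_const: "L (\<lambda>_. c) = c"
    and L_add: "P f \<Longrightarrow> P g \<Longrightarrow> L (\<lambda>x. f x + g x) = L f + L g"
    and L_cmult: "P f \<Longrightarrow> L (\<lambda>x. c * f x) = c * L f"
    and L_nonneg: "P f \<Longrightarrow> (\<And>x. x \<in> S \<Longrightarrow> 0 \<le> f x) \<Longrightarrow> 0 \<le> L f"
    and L_incseq: "(\<And>n. P (s n)) \<Longrightarrow> (\<And>x. x \<in> S \<Longrightarrow> incseq (\<lambda>n. s n x)) \<Longrightarrow>
      (\<And>x. x \<in> S \<Longrightarrow> (\<lambda>n. s n x) \<longlonglongrightarrow> f x) \<Longrightarrow> P f \<Longrightarrow> (\<lambda>n. L (s n)) \<longlonglongrightarrow> L f"
begin

definition expectation_measure :: "'a measure" where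
  "expectation_measure = measure_of S indicator_sets (\<lambda>E. ennreal (L (indicator E)))"

lemma space_expectation_measure [simp]: "space expectation_measure = S"
  and sets_expectation_measure [simp]: "sets expectation_measure = indicator_sets"
  using sigma_algebra_indicator_sets unfolding expectation_measure_def
  by (simp_all add: sigma_algebra.space_measure_of_eq sigma_algebra.sets_measure_of_eq)

text \<open>For a finitely additive set function, countable additivity amounts to continuity from
  below, and the latter is \<open>L_incseq\<close> applied to indicators.\<close>

lemma emeasure_expectation_measure:
  assumes E: "E \<in> indicator_sets"
  shows "emeasure expectation_measure E = ennreal (L (indicator E))"
  unfolding expectation_measure_def
proof (rule emeasure_measure_of_sigma[OF sigma_algebra_indicator_sets _ _ E])
  interpret sigma_algebra S indicator_sets by (rule sigma_algebra_indicator_sets)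
  let ?f = "\<lambda>E. ennreal (L (indicator E))"
  have P: "P (indicator E)" if "E \<in> indicator_sets" for E
    using that by (simp add: indicator_sets_def)
  have pos: "0 \<le> L (indicator E)" if "E \<in> indicator_sets" for E
    by (rule L_nonneg[OF P[OF that]]) simp
  show positive: "positive indicator_sets ?f"
    using L_cong[OF const[of 0], of "indicator {}"] L_const[of 0]
    by (simp add: positive_def)
  have "additive indicator_sets ?f"
    unfolding additive_def
  proof (intro ballI impI)
    fix A B assume AB: "A \<in> indicator_sets" "B \<in> indicator_sets" "A \<inter> B = {}"
    then have "L (indicator (A \<union> B)) = L (\<lambda>x. indicator A x + indicator B x)"
      by (intro L_cong add P) (auto simp: indicator_def)
    also have "\<dots> = L (indicator A) + L (indicator B)"
      by (intro L_add P AB)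
    finally show "?f (A \<union> B) = ?f A + ?f B"
      using AB by (simp add: ennreal_plus pos)
  qed
  from countably_additive_iff_continuous_from_below[OF positive this]
  show "countably_additive indicator_sets ?f"
    apply (rule iffD2)
  proof (intro allI impI)
    fix A :: "nat \<Rightarrow> 'a set"
    assume A: "range A \<subseteq> indicator_sets" "incseq A" "(\<Union>i. A i) \<in> indicator_sets"
    have "(\<lambda>i. L (indicator (A i))) \<longlonglongrightarrow> L (indicator (\<Union>i. A i))"
    proof (rule L_incseq)
      show "incseq (\<lambda>n. indicator (A n) x :: real)" for x
        using A(2) by (auto simp: incseq_def intro!: indicator_leI)
    qed (use A in \<open>auto intro!: P LIMSEQ_indicator_incseq\<close>)
    then show "(\<lambda>i. ?f (A i)) \<longlonglongrightarrow> ?f (\<Union>i. A i)" by (rule tendsto_ennrealI)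
  qed
qed

lemma measure_expectation_measure:
  "E \<in> indicator_sets \<Longrightarrow> measure expectation_measure E = L (indicator E)"
  using L_nonneg[of "indicator E"]
  by (simp add: measure_def emeasure_expectation_measure indicator_sets_def)

sublocale prob_space expectation_measure
proof
  have S: "S \<in> indicator_sets"
    using sets.top[of expectation_measure] by simp
  have "L (indicator S) = L (\<lambda>_. 1)" by (intro L_cong const) simp
  then show "emeasure expectation_measure (space expectation_measure) = 1"
    using emeasure_expectation_measure[OF S] by (simp add: L_const)
qed

lemma borel_measurable_expectation_measure:
  "(borel_measurable expectation_measure :: ('a \<Rightarrow> real) set) = borel_measurable (sigma S indicator_sets)"
  by (rule measurable_cong_sets) simp_all

lemma measurable_expectation_measure:
  "P f \<Longrightarrow> f \<in> borel_measurable expectation_measure"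
  unfolding borel_measurable_expectation_measure by (rule measurable)

lemma integrable_expectation_measure:
  assumes f: "P f"
  shows "integrable expectation_measure f"
proof -
  from bounded[OF f] obtain C where "\<And>x. x \<in> S \<Longrightarrow> norm (f x) \<le> C" by (auto simp: bounded_iff)
  then have "AE x in expectation_measure. norm (f x) \<le> C"
    by (intro AE_I2) simp
  then show ?thesis
    by (rule integrable_const_bound) (rule measurable_expectation_measure[OF f])
qed

lemma integral_expectation_measure_nonneg:
  assumes f: "P f" and nonneg: "\<And>x. 0 \<le> f x"
  shows "integral\<^sup>L expectation_measure f = L f"
proof -
  have "P f \<longrightarrow> integral\<^sup>L expectation_measure f = L f"
    using measurable_expectation_measure[OF f] nonneg
  proof (induction rule: borel_measurable_induct_real)
    case (set A)
    then have "A \<inter> S = A" by (auto simp: indicator_sets_def)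
    with set show ?case
      by (simp add: measure_expectation_measure)
  next
    case (mult u c)
    show ?case
    proof (cases "c = 0")
      case False
      then have "P (\<lambda>x. c * u x) \<Longrightarrow> P u"
        using cong[OF cmult[of "\<lambda>x. c * u x" "inverse c"], of u] by (simp add: field_simps)
      with mult.IH L_cmult[of u c] show ?thesis by simp
    qed (simp add: L_const)
  next
    case (add u v)
    \<comment> \<open>This hands membership from a sum down to its summands: domination gives
      boundedness, and bounded nonnegative measurable functions belong to the algebra.\<close>
    have "P g" if "P h" "\<And>x. 0 \<le> g x" "\<And>x. g x \<le> h x" "g \<in> borel_measurable expectation_measure" for g h
    proof (rule measurable_nonneg_imp)
      show "g \<in> borel_measurable (sigma S indicator_sets)"
        using that(4) unfolding borel_measurable_expectation_measure .
      show "bounded (g ` S)"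
        using bounded_nonneg_le[OF bounded[OF that(1)]] that(2,3) by blast
    qed (rule that)
    note P = this
    show ?case
    proof
      assume "P (\<lambda>x. v x + u x)"
      then have "P v" "P u" using add.hyps by (auto elim: P)
      with add.IH show "integral\<^sup>L expectation_measure (\<lambda>x. v x + u x) = L (\<lambda>x. v x + u x)"
        by (simp add: integrable_expectation_measure L_add)
    qed
  next
    case (seq U)
    have inc: "incseq (\<lambda>n. U n x)" for x
        using \<open>incseq U\<close> by (simp add: incseq_def le_fun_def)
    show ?case
    proof
      assume f: "P f"
      have le: "U n x \<le> f x" if "x \<in> S" for n x
        by (rule incseq_le[OF inc]) (simp add: seq.hyps(4) that)
      have U: "P (U n)" for n
      proof (rule measurable_nonneg_imp)
        show "U n \<in> borel_measurable (sigma S indicator_sets)"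
          using seq.hyps(1)[of n] unfolding borel_measurable_expectation_measure .
        show "bounded (U n ` S)"
          using bounded_nonneg_le[OF bounded[OF f]] le seq.hyps(2) by blast
      qed (rule seq.hyps(2))
      have "(\<lambda>n. integral\<^sup>L expectation_measure (U n)) \<longlonglongrightarrow> integral\<^sup>L expectation_measure f"
      proof (rule integral_dominated_convergence)
        show "integrable expectation_measure f" by (rule integrable_expectation_measure[OF f])
        show "AE x in expectation_measure. norm (U n x) \<le> f x" for n
          by (intro AE_I2) (simp add: le seq.hyps(2))
        show "AE x in expectation_measure. (\<lambda>n. U n x) \<longlonglongrightarrow> f x"
          by (intro AE_I2 seq.hyps(4))
      qed (fact seq.hyps(1) measurable_expectation_measure[OF f])+
      moreover have "(\<lambda>n. L (U n)) \<longlonglongrightarrow> L f"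
        by (rule L_incseq[OF U]) (simp_all add: inc seq.hyps(4) f)
      moreover have "integral\<^sup>L expectation_measure (U n) = L (U n)" for n
        using seq.IH U by blast
      ultimately show "integral\<^sup>L expectation_measure f = L f"
        by (simp add: LIMSEQ_unique)
    qed
  qed
  with f show ?thesis by blast
qed

lemma integral_expectation_measure:
  assumes f: "P f"
  shows "integral\<^sup>L expectation_measure f = L f"
proof -
  from bounded[OF f] obtain C where C: "\<And>x. x \<in> S \<Longrightarrow> \<bar>f x\<bar> \<le> C" by (auto simp: bounded_iff)
  define g where "g x = max 0 (f x + C)" for x
  have g: "g x = f x + C" if "x \<in> S" for x using C[OF that] by (simp add: g_def)
  have P: "P (\<lambda>x. f x + C)" by (intro add f const)
  have "L f + C = L (\<lambda>x. f x + C)" using L_add[OF f const, of C] by (simp add: L_const)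
  also have "\<dots> = L g" by (rule L_cong[OF P g, symmetric])
  also have "\<dots> = integral\<^sup>L expectation_measure g"
    by (rule integral_expectation_measure_nonneg[symmetric, OF cong[OF P g]]) (simp_all add: g_def)
  also have "\<dots> = integral\<^sup>L expectation_measure (\<lambda>x. f x + C)"
    by (rule Bochner_Integration.integral_cong) (simp_all add: g)
  also have "\<dots> = integral\<^sup>L expectation_measure f + C"
    using integrable_expectation_measure[OF f] by (simp add: prob_space[simplified])
  finally show ?thesis by simp
qed

text \<open>Uniqueness comes from indicators, whose integrals are the measures of the sets.
  Integrability is demanded explicitly because the integral of a non-integrable function has the
  default value 0.\<close>

theorem unique_representing_measure:
  "\<exists>!\<mu>. prob_space \<mu> \<and> space \<mu> = S \<and> sets \<mu> = indicator_sets \<and>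
    (\<forall>f. P f \<longrightarrow> integrable \<mu> f \<and> L f = integral\<^sup>L \<mu> f)"
proof (rule ex1I[of _ expectation_measure])
  show "prob_space expectation_measure \<and> space expectation_measure = S \<and>
    sets expectation_measure = indicator_sets \<and> (\<forall>f. P f \<longrightarrow>
      integrable expectation_measure f \<and> L f = integral\<^sup>L expectation_measure f)"
    by (simp add: prob_space_axioms integrable_expectation_measure integral_expectation_measure)
next
  fix \<nu> assume \<nu>: "prob_space \<nu> \<and> space \<nu> = S \<and> sets \<nu> = indicator_sets \<and>
    (\<forall>f. P f \<longrightarrow> integrable \<nu> f \<and> L f = integral\<^sup>L \<nu> f)"
  then interpret \<nu>: prob_space \<nu> by simp
  show "\<nu> = expectation_measure"
  proof (rule measure_eqI)
    fix E assume "E \<in> sets \<nu>"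
    with \<nu> have E: "E \<in> indicator_sets" "P (indicator E)" "E \<inter> S = E"
      by (auto simp: indicator_sets_def)
    then have "L (indicator E) = measure \<nu> E" using \<nu> by simp
    then show "emeasure \<nu> E = emeasure expectation_measure E"
      using E by (simp add: emeasure_expectation_measure \<nu>.emeasure_eq_measure)
  qed (use \<nu> in simp)
qed

end


section \<open>Maximality of Dirac measures at extreme points\<close>

lemma tendsto_scaleR_locally_convex:
  fixes g :: "'b \<Rightarrow> 'a::locally_convex_space"
  assumes "(f \<longlongrightarrow> c) F" "(g \<longlongrightarrow> x) F"
  shows "((\<lambda>t. f t *\<^sub>R g t) \<longlongrightarrow> c *\<^sub>R x) F"
  using filterlim_compose[OF tendsto_scaleR_nhds filterlim_Pair[OF assms]] by simp

lemma continuous_on_scaleR_locally_convex: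
  fixes g :: "'b::topological_space \<Rightarrow> 'a::locally_convex_space"
  assumes "continuous_on S f" "continuous_on S g"
  shows "continuous_on S (\<lambda>t. f t *\<^sub>R g t)"
  using assms unfolding continuous_on_def by (auto intro: tendsto_scaleR_locally_convex)

text \<open>Normalising the weights reduces this to convexity; if both weights vanish, any point of
  \<open>C\<close> serves. It merges points of a mixture whose weights do not sum to 1.\<close>

lemma convex_nonneg_combination:
  assumes "convex C" "a \<in> C" "b \<in> C" "0 \<le> u" "0 \<le> v"
  obtains c where "c \<in> C" "u *\<^sub>R a + v *\<^sub>R b = (u + v) *\<^sub>R c"
proof (cases "u + v = 0")
  case True
  with assms have "u = 0" "v = 0" by auto
  with assms(2) that show ?thesis by auto
next
  case False
  with assms have "(u / (u + v)) *\<^sub>R a + (v / (u + v)) *\<^sub>R b \<in> C"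
    by (intro convexD) (auto simp: add_divide_distrib[symmetric])
  moreover have "u *\<^sub>R a + v *\<^sub>R b = (u + v) *\<^sub>R ((u / (u + v)) *\<^sub>R a + (v / (u + v)) *\<^sub>R b)"
    using False by (simp add: scaleR_add_right)
  ultimately show ?thesis using that by blast
qed

section \<open>Continuous seminorms\<close>

locale continuous_seminorm =
  fixes p :: "'a::locally_convex_space \<Rightarrow> real"
  assumes nonneg: "0 \<le> p x"
    and triangle: "p (x + y) \<le> p x + p y"
    and scale: "0 \<le> c \<Longrightarrow> p (c *\<^sub>R x) = c * p x"
    and minus: "p (- x) = p x"
    and continuous: "continuous_on UNIV p"
begin

lemma zero [simp]: "p 0 = 0"
  using scale[of 0 0] by simp

text \<open>By symmetry of \<open>p\<close> the one-sided bound is two-sided, and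
  \<open>p (z - y)\<close> tends to \<open>p 0 = 0\<close> as \<open>z\<close> tends to
  \<open>y\<close>.\<close>

lemma continuous_on_of_lipschitz:
  fixes f :: "'a \<Rightarrow> real"
  assumes lip: "\<And>y z. y \<in> S \<Longrightarrow> z \<in> S \<Longrightarrow> f y \<le> f z + p (y - z)"
  shows "continuous_on S f"
  unfolding continuous_on_def
proof
  fix y assume y: "y \<in> S"
  have "(p \<longlongrightarrow> p 0) (nhds 0)"
    using continuous unfolding continuous_on_def tendsto_at_iff_tendsto_nhds by blast
  moreover have "((\<lambda>z. z - y) \<longlongrightarrow> y - y) (at y within S)"
    by (intro tendsto_intros)
  ultimately have "((\<lambda>z. p (z - y)) \<longlongrightarrow> 0) (at y within S)"
    using filterlim_compose[of p "nhds (p 0)" "nhds 0"] by simp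
  moreover have "norm (f z - f y) \<le> p (z - y)" if "z \<in> S" for z
    using lip[OF y that] lip[OF that y] minus[of "y - z"] by simp
  then have "eventually (\<lambda>z. norm (f z - f y) \<le> p (z - y)) (at y within S)"
    by (auto simp: eventually_at_topological)
  ultimately have "((\<lambda>z. f z - f y) \<longlongrightarrow> 0) (at y within S)"
    by (rule Lim_null_comparison[rotated])
  then show "(f \<longlongrightarrow> f y) (at y within S)" by (rule LIM_zero_cancel)
qed

end

text \<open>The Minkowski functional of a symmetric convex open neighbourhood of 0.\<close>

lemma continuous_seminorm_in_open:
  fixes U :: "'a::locally_convex_space set"
  assumes U: "open U" "0 \<in> U"
  obtains p where "continuous_seminorm p" "\<And>v. p v < 1 \<Longrightarrow> v \<in> U"
proof -
  obtain V where V: "open V" "0 \<in> V" "V \<subseteq> U"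
    "\<And>x y u v. x \<in> V \<Longrightarrow> y \<in> V \<Longrightarrow> 0 \<le> u \<Longrightarrow> 0 \<le> v \<Longrightarrow> u + v = (1::real) \<Longrightarrow> u *\<^sub>R x + v *\<^sub>R y \<in> V"
    using locally_convex[OF U] by metis
  define W where "W = V \<inter> uminus -` V"
  have "open (uminus -` V)"
    by (rule open_vimage[OF V(1)]) (intro continuous_intros)
  then have W: "open W" "0 \<in> W" "W \<subseteq> U" using V by (auto simp: W_def)
  have W_minus: "- x \<in> W \<longleftrightarrow> x \<in> W" for x by (auto simp: W_def)
  have W_convex: "u *\<^sub>R x + v *\<^sub>R y \<in> W"
    if "x \<in> W" "y \<in> W" "0 \<le> u" "0 \<le> v" "u + v = 1" for x y u v
    using that V(4)[of x y u v] V(4)[of "- x" "- y" u v] by (auto simp: W_def)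
  define T where "T v = {t. 0 < t \<and> inverse t *\<^sub>R v \<in> W}" for v
  define p where "p v = Inf (T v)" for v
  have "T v \<noteq> {}" for v
  proof -
    \<comment> \<open>\<open>W\<close> is absorbing: \<open>v / t\<close> tends to 0 as
      \<open>t\<close> grows and so enters \<open>W\<close>.\<close>
    have "((\<lambda>t. inverse t *\<^sub>R v) \<longlongrightarrow> 0 *\<^sub>R v) at_top"
      by (rule tendsto_scaleR_locally_convex[OF tendsto_inverse_0_at_top[OF filterlim_ident] tendsto_const])
    then have "eventually (\<lambda>t::real. inverse t *\<^sub>R v \<in> W) at_top"
      using W by (intro topological_tendstoD[of _ "0 *\<^sub>R v"]) auto
    then have "eventually (\<lambda>t::real. 0 < t \<and> inverse t *\<^sub>R v \<in> W) at_top"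
      by (intro eventually_conj eventually_gt_at_top)
    from eventually_happens[OF this] show ?thesis by (auto simp: T_def)
  qed
  note T_nonempty = this
  have bdd: "bdd_below (T v)" for v by (rule bdd_belowI[of _ 0]) (auto simp: T_def)
  have T_pos: "0 < t" if "t \<in> T v" for t v using that by (simp add: T_def)
  have T_up: "s \<in> T v" if "t \<in> T v" "t \<le> s" for s t v
  proof -
    from that have "0 < t" "0 < s" by (auto simp: T_def)
    \<comment> \<open>The point \<open>v / s\<close> lies between \<open>v / t\<close> and 0. Hence
      \<open>T v\<close> is upward closed and contains everything above its infimum.\<close>
    have "(t / s) *\<^sub>R (inverse t *\<^sub>R v) + (1 - t / s) *\<^sub>R 0 \<in> W"
      using that \<open>0 < t\<close> \<open>0 < s\<close> W(2) by (intro W_convex) (auto simp: T_def)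
    with \<open>0 < t\<close> \<open>0 < s\<close> show ?thesis by (simp add: T_def field_simps)
  qed
  have p_le: "p v \<le> t" if "t \<in> T v" for t v
    unfolding p_def by (rule cInf_lower[OF that bdd])
  have T_I: "t \<in> T v" if "p v < t" for t v
  proof -
    from that obtain s where "s \<in> T v" "s < t"
      using cInf_lessD[OF T_nonempty] unfolding p_def by blast
    then show ?thesis by (blast intro: T_up less_imp_le)
  qed
  have nonneg: "0 \<le> p v" for v
    unfolding p_def by (rule cInf_greatest[OF T_nonempty]) (auto dest: T_pos)
  have triangle: "p (x + y) \<le> p x + p y" for x y
  proof (rule field_le_epsilon)
    fix e :: real assume "0 < e"
    define s where "s = p x + e / 2"
    define t where "t = p y + e / 2"
    have st: "0 < s" "0 < t" using nonneg[of x] nonneg[of y] \<open>0 < e\<close> by (auto simp: s_def t_def)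
    have "s \<in> T x" "t \<in> T y" using \<open>0 < e\<close> by (auto simp: s_def t_def intro!: T_I)
    \<comment> \<open>\<open>(x + y) / (s + t)\<close> is the convex combination of
      \<open>x / s\<close> and \<open>y / t\<close> with weights proportional to \<open>s\<close>
      and \<open>t\<close>.\<close>
    then have "(s / (s + t)) *\<^sub>R (inverse s *\<^sub>R x) + (t / (s + t)) *\<^sub>R (inverse t *\<^sub>R y) \<in> W"
      using st by (intro W_convex) (auto simp: T_def add_divide_distrib[symmetric])
    also have "(s / (s + t)) *\<^sub>R (inverse s *\<^sub>R x) + (t / (s + t)) *\<^sub>R (inverse t *\<^sub>R y)
      = inverse (s + t) *\<^sub>R (x + y)"
    proof -
      have "s / (s + t) * inverse s = inverse (s + t)" "t / (s + t) * inverse t = inverse (s + t)"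
        using st by (simp_all add: field_simps)
      then show ?thesis by (simp only: scaleR_add_right scaleR_scaleR)
    qed
    finally have "s + t \<in> T (x + y)" using st by (simp add: T_def)
    from p_le[OF this] show "p (x + y) \<le> p x + p y + e" by (simp add: s_def t_def)
  qed
  have scale_le: "p (c *\<^sub>R x) \<le> c * p x" if c: "0 < c" for c x
  proof (rule field_le_epsilon)
    fix e :: real assume "0 < e"
    then have "p x + e / c \<in> T x" using c by (intro T_I) simp
    moreover have "inverse (c * (p x + e / c)) * c = inverse (p x + e / c)" using c by simp
    ultimately have "c * (p x + e / c) \<in> T (c *\<^sub>R x)"
      using c by (simp only: T_def mem_Collect_eq scaleR_scaleR) simp
    from p_le[OF this] c show "p (c *\<^sub>R x) \<le> c * p x + e" by (simp add: distrib_left)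
  qed
  have zero: "p 0 = 0"
  proof (rule antisym[OF field_le_epsilon nonneg])
    fix e :: real assume "0 < e"
    then show "p 0 \<le> 0 + e" using W by (intro p_le) (simp add: T_def)
  qed
  have scale: "p (c *\<^sub>R x) = c * p x" if "0 \<le> c" for c x
  proof (cases "c = 0")
    case False
    with that have "0 < c" by simp
    \<comment> \<open>The reverse inequality is \<open>scale_le\<close> for the inverse
      factor.\<close>
    from scale_le[OF this, of x] scale_le[of "inverse c" "c *\<^sub>R x"] this show ?thesis
      by (simp add: field_simps)
  qed (simp add: zero)
  have minus: "p (- x) = p x" for x
    using W_minus by (simp add: p_def T_def)
  have "continuous_on UNIV p"
    unfolding continuous_on_def
  proof
    fix x
    show "(p \<longlongrightarrow> p x) (at x)"
    proof (rule tendstoI)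
      fix e :: real assume "0 < e"
      \<comment> \<open>Once the scaled difference is in \<open>W\<close>,
        \<open>p (y - x) \<le> e / 2\<close>; the factor 2 leaves room for the strict
        inequality.\<close>
      have "((\<lambda>y. (2 / e) *\<^sub>R (y - x)) \<longlongrightarrow> (2 / e) *\<^sub>R (x - x)) (at x)"
        by (rule tendsto_scaleR_locally_convex) (intro tendsto_intros)+
      then have "eventually (\<lambda>y. (2 / e) *\<^sub>R (y - x) \<in> W) (at x)"
        using W by (intro topological_tendstoD[of _ "(2 / e) *\<^sub>R (x - x)"]) auto
      then show "eventually (\<lambda>y. dist (p y) (p x) < e) (at x)"
      proof eventually_elim
        case (elim y)
        then have "e / 2 \<in> T (y - x)" using \<open>0 < e\<close> by (simp add: T_def)
        then have "p (y - x) \<le> e / 2" by (rule p_le)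
        moreover have "p (x - y) = p (y - x)" using minus[of "x - y"] by simp
        moreover have "p y \<le> p (y - x) + p x" "p x \<le> p (x - y) + p y"
          using triangle[of "y - x" x] triangle[of "x - y" y] by simp_all
        ultimately show ?case using \<open>0 < e\<close> by (simp add: dist_real_def)
      qed
    qed
  qed
  then have "continuous_seminorm p"
    using nonneg triangle scale minus by unfold_locales
  moreover have "v \<in> U" if "p v < 1" for v
    using T_I[OF that] W(3) by (auto simp: T_def)
  ultimately show ?thesis by (rule that)
qed

text \<open>The function is the infimum over \<open>s \<in> [0, 1]\<close>, \<open>c \<in> C\<close>, \<open>z \<in> X\<close> of
  \<open>p (y - (s c + (1 - s) z)) - s\<close> for a seminorm \<open>p\<close> that is at least 1 at the differences of
  \<open>x\<close> and the points with \<open>s \<ge> \<epsilon>\<close>; extremality keeps \<open>x\<close> away from these points. It replaces a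
  Hahn-Banach separation.\<close>

lemma extreme_point_convex_function:
  fixes X :: "'a::locally_convex_space set"
  assumes X: "compact X" "convex X" and x: "x \<in> ext X"
    and C: "compact C" "convex C" "C \<subseteq> X" "x \<notin> C" and \<epsilon>: "0 < \<epsilon>"
  obtains f where "convex_on X f" "continuous_on X f" "\<And>y. y \<in> X \<Longrightarrow> -1 \<le> f y \<and> f y \<le> 0"
    "\<And>y. y \<in> C \<Longrightarrow> f y \<le> -1" "-\<epsilon> \<le> f x"
proof (cases "C = {}")
  case True
  show ?thesis
    by (rule that[of "\<lambda>_. 0"]) (use True X(2) \<epsilon> in \<open>auto simp: convex_on_def\<close>)
next
  case False
  then obtain c0 where c0: "c0 \<in> C" by blast
  define m where "m q = fst q *\<^sub>R fst (snd q) + (1 - fst q) *\<^sub>R snd (snd q)" for q :: "real \<times> 'a \<times> 'a"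
  define Q where "Q = {0..1::real} \<times> C \<times> X"
  \<comment> \<open>\<open>K\<close> collects the mixtures that give \<open>C\<close> weight at
    least \<open>\<epsilon>\<close>. It is compact, so \<open>x\<close> has a neighbourhood avoiding
    it as soon as \<open>x \<notin> K\<close>.\<close>
  define K where "K = m ` ({\<epsilon>..1} \<times> C \<times> X)"
  have "continuous_on A m" for A
    unfolding m_def
    by (intro continuous_on_add continuous_on_scaleR_locally_convex continuous_intros)
  then have "compact K"
    unfolding K_def by (intro compact_continuous_image compact_Times X C compact_Icc)
  then have "closed K" by (rule compact_imp_closed)
  have "x \<notin> K"
  proof
    assume "x \<in> K"
    then obtain s c z where s: "\<epsilon> \<le> s" "s \<le> 1" and c: "c \<in> C" and z: "z \<in> X"
      and eq: "x = s *\<^sub>R c + (1 - s) *\<^sub>R z"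
      by (auto simp: K_def m_def)
    \<comment> \<open>Since \<open>x \<notin> C\<close>, the degenerate cases \<open>s = 1\<close>
      and \<open>c = z\<close> are excluded, and \<open>x\<close> would be interior to a segment in
      \<open>X\<close>, against extremality.\<close>
    have "x \<noteq> c" using C c by blast
    have "c \<noteq> z" using eq \<open>x \<noteq> c\<close> by (auto simp: scaleR_add_left[symmetric])
    moreover have "s \<noteq> 1" using eq \<open>x \<noteq> c\<close> by auto
    ultimately have "x \<in> open_segment z c"
      using s \<epsilon> eq by (auto simp: in_segment add.commute intro!: exI[of _ s])
    moreover have "c \<in> X" using c C by blast
    ultimately show False using x z by (auto simp: ext_def extreme_point_of_def)
  qed
  \<comment> \<open>This neighbourhood of 0 is chosen so that \<open>p (x - k) \<ge> 1\<close> for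
    every \<open>k\<close> in \<open>K\<close>.\<close>
  have "open ((\<lambda>v. x - v) -` (- K))"
    by (intro open_vimage continuous_intros open_Compl \<open>closed K\<close>)
  moreover have "0 \<in> (\<lambda>v. x - v) -` (- K)" using \<open>x \<notin> K\<close> by simp
  ultimately obtain p where "continuous_seminorm p" and p: "\<And>v. p v < 1 \<Longrightarrow> x - v \<notin> K"
    by (elim continuous_seminorm_in_open[of "(\<lambda>v. x - v) -` (- K)"]) auto
  interpret continuous_seminorm p by fact
  define g where "g y q = p (y - m q) - fst q" for y q
  define f where "f y = (INF q\<in>Q. g y q)" for y
  have Q_nonempty: "Q \<noteq> {}" using c0 C by (auto simp: Q_def)
  have g_ge: "-1 \<le> g y q" if "q \<in> Q" for y q
    using nonneg[of "y - m q"] that by (auto simp: g_def Q_def)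
  have bdd: "bdd_below (g y ` Q)" for y by (rule bdd_belowI2[of _ "-1"]) (rule g_ge)
  have f_le: "f y \<le> g y q" if "q \<in> Q" for y q
    unfolding f_def by (rule cINF_lower[OF bdd that])
  have f_ge: "a \<le> f y" if "\<And>q. q \<in> Q \<Longrightarrow> a \<le> g y q" for a y
    unfolding f_def by (rule cINF_greatest[OF Q_nonempty that])
  show ?thesis
  proof (rule that[of f])
    fix y assume "y \<in> X"
    \<comment> \<open>Weight 0 on \<open>C\<close> with \<open>z = y\<close> has
      \<open>m q = y\<close> and value 0; for \<open>y\<close> in \<open>C\<close>, weight 1 with
      \<open>c = y\<close> likewise gives -1 below.\<close>
    then show "-1 \<le> f y \<and> f y \<le> 0"
      using f_le[of "(0, c0, y)" y] f_ge[of "-1" y] g_ge c0 by (auto simp: Q_def g_def m_def)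
  next
    fix y assume "y \<in> C"
    then show "f y \<le> -1"
      using f_le[of "(1, y, y)" y] C by (auto simp: Q_def g_def m_def)
  next
    show "-\<epsilon> \<le> f x"
    proof (rule f_ge)
      fix q assume q: "q \<in> Q"
      show "-\<epsilon> \<le> g x q"
      \<comment> \<open>A weight of at least \<open>\<epsilon>\<close> puts \<open>m q\<close> in
        \<open>K\<close>, where \<open>p \<ge> 1\<close> compensates for the subtracted weight; a
        smaller weight subtracts less than \<open>\<epsilon>\<close>.\<close>
      proof (cases "\<epsilon> \<le> fst q")
        case True
        with q have "m q \<in> K" by (auto simp: K_def Q_def)
        then have "1 \<le> p (x - m q)" using p[of "x - m q"] by fastforce
        moreover have "fst q \<le> 1" using q by (auto simp: Q_def)
        ultimately show ?thesis using \<epsilon> by (simp add: g_def)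
      next
        case False
        then show ?thesis using nonneg[of "x - m q"] by (simp add: g_def)
      qed
    qed
  next
    show "continuous_on X f"
    proof (rule continuous_on_of_lipschitz)
      fix y z
      \<comment> \<open>Each \<open>g y q\<close> is 1-Lipschitz in \<open>y\<close> with respect to
        \<open>p\<close>, and the infimum inherits this.\<close>
      have "f y - p (y - z) \<le> f z"
      proof (rule f_ge)
        fix q assume "q \<in> Q"
        have "p (y - m q) \<le> p (y - z) + p (z - m q)"
          using triangle[of "y - z" "z - m q"] by simp
        then show "f y - p (y - z) \<le> g z q"
          using f_le[OF \<open>q \<in> Q\<close>, of y] by (simp add: g_def)
      qed
      then show "f y \<le> f z + p (y - z)" by simp
    qed
  next
    show "convex_on X f"
    proof (rule convex_onI[OF _ X(2)])
      fix t :: real and y1 y2 :: 'a assume t: "0 < t" "t < 1"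
      let ?y = "(1 - t) *\<^sub>R y1 + t *\<^sub>R y2"
      \<comment> \<open>Mixing the parameters: the parts in \<open>C\<close> merge into one point of
        \<open>C\<close> of weight \<open>?s\<close>, those in \<open>X\<close> into one point of
        \<open>X\<close>. Thus \<open>m\<close> of the new parameter is the mixture of
        \<open>m q1\<close> and \<open>m q2\<close>.\<close>
      have le: "f ?y \<le> (1 - t) * g y1 q1 + t * g y2 q2" if q: "q1 \<in> Q" "q2 \<in> Q" for q1 q2
      proof -
        obtain s1 c1 z1 where q1: "q1 = (s1, c1, z1)" by (cases q1)
        obtain s2 c2 z2 where q2: "q2 = (s2, c2, z2)" by (cases q2)
        have s: "0 \<le> s1" "s1 \<le> 1" "0 \<le> s2" "s2 \<le> 1" and cz: "c1 \<in> C" "c2 \<in> C" "z1 \<in> X" "z2 \<in> X"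
          using q by (auto simp: q1 q2 Q_def)
        let ?s = "(1 - t) * s1 + t * s2"
        obtain c where c: "c \<in> C" "((1 - t) * s1) *\<^sub>R c1 + (t * s2) *\<^sub>R c2 = ?s *\<^sub>R c"
          using convex_nonneg_combination[OF C(2) cz(1,2), of "(1 - t) * s1" "t * s2"] s t by auto
        obtain z where z: "z \<in> X" "((1 - t) * (1 - s1)) *\<^sub>R z1 + (t * (1 - s2)) *\<^sub>R z2
            = ((1 - t) * (1 - s1) + t * (1 - s2)) *\<^sub>R z"
          using convex_nonneg_combination[OF X(2) cz(3,4), of "(1 - t) * (1 - s1)" "t * (1 - s2)"] s t
          by auto
        have s': "(1 - t) * (1 - s1) + t * (1 - s2) = 1 - ?s" by (simp add: algebra_simps)
        have "?s \<le> (1 - t) * 1 + t * 1" using s t by (intro add_mono mult_left_mono) auto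
        then have q: "(?s, c, z) \<in> Q" using c z s t by (simp add: Q_def)
        have "(1 - t) *\<^sub>R m q1 + t *\<^sub>R m q2
          = (((1 - t) * s1) *\<^sub>R c1 + (t * s2) *\<^sub>R c2)
            + (((1 - t) * (1 - s1)) *\<^sub>R z1 + (t * (1 - s2)) *\<^sub>R z2)"
          by (simp add: m_def q1 q2 scaleR_add_right)
        also have "\<dots> = m (?s, c, z)" unfolding c(2) z(2) s' by (simp add: m_def)
        finally have m_eq: "m (?s, c, z) = (1 - t) *\<^sub>R m q1 + t *\<^sub>R m q2" by (rule sym)
        have "?y - m (?s, c, z) = (1 - t) *\<^sub>R (y1 - m q1) + t *\<^sub>R (y2 - m q2)"
          unfolding m_eq by (simp add: algebra_simps)
        then have "p (?y - m (?s, c, z)) \<le> (1 - t) * p (y1 - m q1) + t * p (y2 - m q2)"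
          using triangle[of "(1 - t) *\<^sub>R (y1 - m q1)" "t *\<^sub>R (y2 - m q2)"] t by (simp add: scale)
        then show ?thesis
          using f_le[OF q, of ?y] by (simp add: g_def q1 q2 algebra_simps)
      qed
      show "f ?y \<le> (1 - t) * f y1 + t * f y2"
      proof (rule field_le_epsilon)
        fix e :: real assume "0 < e"
        have "\<exists>q\<in>Q. g y q < f y + e" for y
          using cINF_less_iff[OF Q_nonempty bdd, of y "f y + e"] \<open>0 < e\<close> by (simp add: f_def)
        then obtain q1 q2 where q: "q1 \<in> Q" "q2 \<in> Q" "g y1 q1 < f y1 + e" "g y2 q2 < f y2 + e"
          by meson
        have "f ?y \<le> (1 - t) * g y1 q1 + t * g y2 q2" by (rule le[OF q(1,2)])
        also have "\<dots> \<le> (1 - t) * (f y1 + e) + t * (f y2 + e)"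
          using q t by (intro add_mono mult_left_mono) auto
        also have "\<dots> = (1 - t) * f y1 + t * f y2 + e" by (simp add: algebra_simps)
        finally show "f ?y \<le> (1 - t) * f y1 + t * f y2 + e" .
      qed
    qed
  qed
qed

section \<open>Dirac measures in the Choquet order\<close>

abbreviation dirac :: "'a::locally_convex_space set \<Rightarrow> 'a \<Rightarrow> 'a measure" where
  "dirac X x \<equiv> return (restrict_space borel X) x"

lemma compact_subset_sets:
  fixes X :: "'a::t2_space set"
  assumes "compact K" "K \<subseteq> X"
  shows "K \<in> sets (restrict_space borel X)"
  using assms compact_imp_closed[OF assms(1)]
  by (auto simp: sets_restrict_space intro!: image_eqI[of _ _ K])

lemma choquet_above_dirac:
  fixes X :: "'a::locally_convex_space set"
  assumes X: "compact X" "convex X" and x: "x \<in> ext X"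
    and "prob_space \<nu>" and sets_eq: "sets \<nu> = sets (restrict_space borel X)"
    and regular: "\<And>B. B \<in> sets \<nu> \<Longrightarrow> emeasure \<nu> B = (SUP K\<in>{K. K \<subseteq> B \<and> compact K}. emeasure \<nu> K)"
    and le: "choquet_le X (completion (dirac X x)) (completion \<nu>)"
  shows "\<nu> = dirac X x"
proof -
  interpret prob_space \<nu> by fact
  have space: "space \<nu> = X" using sets_eq_imp_space_eq[OF sets_eq] by (simp add: space_restrict_space)
  have "x \<in> X" using x by (auto simp: ext_def extreme_point_of_def)
  have borel: "f \<in> borel_measurable \<nu>" "f \<in> borel_measurable (dirac X x)"
    if "continuous_on X f" for f :: "'a \<Rightarrow> real"
    using borel_measurable_continuous_on_restrict[OF that]
    by (simp_all add: measurable_cong_sets[OF sets_eq refl])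
  have convex_null: "C \<in> null_sets \<nu>" if C: "compact C" "convex C" "C \<subseteq> X" "x \<notin> C" for C
  proof -
    have C_sets: "C \<in> sets \<nu>" unfolding sets_eq by (rule compact_subset_sets) fact+
    \<comment> \<open>On \<open>X\<close> the convex function \<open>f\<close> lies below minus the
      indicator of \<open>C\<close>, so the order gives
      \<open>-\<epsilon> \<le> f x \<le> - measure \<nu> C\<close>.\<close>
    have "measure \<nu> C \<le> 0 + \<epsilon>" if \<epsilon>: "0 < \<epsilon>" for \<epsilon>
    proof -
      obtain f where f: "convex_on X f" "continuous_on X f" "\<And>y. y \<in> X \<Longrightarrow> -1 \<le> f y \<and> f y \<le> 0"
        "\<And>y. y \<in> C \<Longrightarrow> f y \<le> -1" "-\<epsilon> \<le> f x"
        using extreme_point_convex_function[OF X x C \<epsilon>] by blast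
      have "f x = (\<integral>y. f y \<partial>dirac X x)"
        using \<open>x \<in> X\<close> borel(2)[OF f(2)] by (intro integral_return[symmetric]) (auto simp: space_restrict_space)
      also have "\<dots> = (\<integral>y. f y \<partial>completion (dirac X x))"
        by (rule integral_completion[symmetric]) (rule borel(2)[OF f(2)])
      also have "\<dots> \<le> (\<integral>y. f y \<partial>completion \<nu>)" using le f(1,2) by (simp add: choquet_le_def)
      also have "\<dots> = (\<integral>y. f y \<partial>\<nu>)" by (rule integral_completion) (rule borel(1)[OF f(2)])
      also have "\<dots> \<le> (\<integral>y. - indicator C y \<partial>\<nu>)"
      proof (rule integral_mono)
        show "integrable \<nu> f"
        proof (rule integrable_const_bound)
          show "AE y in \<nu>. norm (f y) \<le> 1"
          proof (rule AE_I2)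
            fix y assume "y \<in> space \<nu>"
            then show "norm (f y) \<le> 1" using f(3)[of y] by (simp add: space)
          qed
        qed (rule borel(1)[OF f(2)])
        show "integrable \<nu> (\<lambda>y. - indicator C y :: real)"
          using C_sets by (intro integrable_minus integrable_real_indicator) (auto simp: emeasure_eq_measure)
        show "f y \<le> - indicator C y" if "y \<in> space \<nu>" for y
          using f(3)[of y] f(4)[of y] that by (auto simp: space split: split_indicator)
      qed
      also have "\<dots> = - measure \<nu> C" using C_sets by simp
      finally show ?thesis using f(5) by simp
    qed
    then have "measure \<nu> C \<le> 0" by (rule field_le_epsilon)
    then have "measure \<nu> C = 0" by (simp add: measure_le_0_iff)
    then show ?thesis using C_sets by (simp add: null_sets_def emeasure_eq_measure)
  qed
  have compact_null: "K \<in> null_sets \<nu>" if K: "compact K" "K \<subseteq> X - {x}" for K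
  proof -
    \<comment> \<open>For a seminorm with \<open>p (x - y) \<ge> 1\<close>, the closed ball of
      radius 1/2 about \<open>y\<close> misses \<open>x\<close>. Its trace on \<open>X\<close> is
      compact and convex, hence null; the open ball serves for the covering.\<close>
    have "\<exists>C G. C \<in> null_sets \<nu> \<and> open G \<and> y \<in> G \<and> G \<inter> X \<subseteq> C" if y: "y \<in> K" for y
    proof -
      have "open ((\<lambda>v. y + v) -` (- {x}))"
        by (intro open_vimage continuous_intros open_Compl closed_singleton)
      moreover have "0 \<in> (\<lambda>v. y + v) -` (- {x})" using y K by auto
      ultimately obtain p where "continuous_seminorm p" and p: "\<And>v. p v < 1 \<Longrightarrow> y + v \<noteq> x"
        by (elim continuous_seminorm_in_open[of "(\<lambda>v. y + v) -` (- {x})"]) auto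
      interpret continuous_seminorm p by fact
      have cont: "continuous_on UNIV (\<lambda>z. p (z - y))"
        by (intro continuous_on_compose2[OF continuous] continuous_intros) auto
      let ?C = "X \<inter> {z. p (z - y) \<le> 1 / 2}"
      let ?G = "{z. p (z - y) < 1 / 2}"
      have "compact ?C"
        by (intro compact_Int_closed X closed_Collect_le cont continuous_on_const)
      moreover have "convex {z. p (z - y) \<le> 1 / 2}"
      proof (rule convexI)
        fix a b and u v :: real
        assume ab: "a \<in> {z. p (z - y) \<le> 1 / 2}" "b \<in> {z. p (z - y) \<le> 1 / 2}"
          and uv: "0 \<le> u" "0 \<le> v" "u + v = 1"
        have "u *\<^sub>R a + v *\<^sub>R b - y = u *\<^sub>R a + v *\<^sub>R b - (u + v) *\<^sub>R y" using uv by simp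
        also have "\<dots> = u *\<^sub>R (a - y) + v *\<^sub>R (b - y)" by (simp add: algebra_simps)
        finally have "p (u *\<^sub>R a + v *\<^sub>R b - y) \<le> u * p (a - y) + v * p (b - y)"
          using triangle[of "u *\<^sub>R (a - y)" "v *\<^sub>R (b - y)"] uv by (simp add: scale)
        also have "\<dots> \<le> u * (1 / 2) + v * (1 / 2)"
          using ab uv by (intro add_mono mult_left_mono) auto
        also have "\<dots> = 1 / 2" using uv by (simp add: distrib_right[symmetric] del: distrib_right)
        finally show "u *\<^sub>R a + v *\<^sub>R b \<in> {z. p (z - y) \<le> 1 / 2}" by simp
      qed
      then have "convex ?C" using X by (intro convex_Int)
      moreover have "x \<notin> ?C" using p[of "x - y"] by auto
      ultimately have "?C \<in> null_sets \<nu>" by (intro convex_null) auto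
      moreover have "open ?G" by (intro open_Collect_less cont continuous_on_const)
      ultimately show ?thesis by (intro exI[of _ ?C] exI[of _ ?G]) auto
    qed
    then have "K \<subseteq> \<Union>{G. open G \<and> (\<exists>C\<in>null_sets \<nu>. G \<inter> X \<subseteq> C)}" by blast
    then obtain F where F: "F \<subseteq> {G. open G \<and> (\<exists>C\<in>null_sets \<nu>. G \<inter> X \<subseteq> C)}" "finite F" "K \<subseteq> \<Union>F"
      by (rule compactE[OF K(1)]) auto
    then have "\<forall>G\<in>F. \<exists>C\<in>null_sets \<nu>. G \<inter> X \<subseteq> C" by blast
    then obtain C where C: "\<forall>G\<in>F. C G \<in> null_sets \<nu> \<and> G \<inter> X \<subseteq> C G"
      by (auto simp: Bex_def dest!: bchoice)
    have "K \<subseteq> (\<Union>G\<in>F. C G)"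
    proof
      fix y assume "y \<in> K"
      with F(3) K(2) obtain G where "G \<in> F" "y \<in> G \<inter> X" by blast
      with C show "y \<in> (\<Union>G\<in>F. C G)" by blast
    qed
    moreover have "(\<Union>G\<in>F. C G) \<in> null_sets \<nu>"
      using F C by (intro null_sets.finite_UN) auto
    moreover have "K \<in> sets \<nu>" unfolding sets_eq using K by (intro compact_subset_sets) auto
    ultimately show ?thesis by (intro null_sets_subset[of "\<Union>G\<in>F. C G" \<nu> K])
  qed
  \<comment> \<open>Inner regularity extends nullity from compact sets to all measurable sets
    avoiding \<open>x\<close>.\<close>
  have null: "emeasure \<nu> B = 0" if "B \<in> sets \<nu>" "x \<notin> B" for B
  proof -
    have "B \<subseteq> X" using sets.sets_into_space[OF that(1)] space by simp
    have "emeasure \<nu> B = (SUP K\<in>{K. K \<subseteq> B \<and> compact K}. 0)"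
      unfolding regular[OF that(1)]
      using compact_null that(2) \<open>B \<subseteq> X\<close> by (intro SUP_cong refl) (auto simp: null_sets_def)
    also have "\<dots> = 0" by (intro antisym SUP_least) auto
    finally show ?thesis .
  qed
  show ?thesis
  proof (rule measure_eqI)
    show "sets \<nu> = sets (dirac X x)" using sets_eq by simp
  next
    fix B assume B: "B \<in> sets \<nu>"
    show "emeasure \<nu> B = emeasure (dirac X x) B"
    proof (cases "x \<in> B")
      case True
      have "emeasure \<nu> (space \<nu> - B) = 0"
        using B True by (intro null) auto
      then have "measure \<nu> B = 1"
        using prob_compl[OF B] by (simp add: emeasure_eq_measure)
      then show ?thesis using B True by (simp add: emeasure_eq_measure sets_eq)
    next
      case False
      then show ?thesis using null[OF B] B by (simp add: sets_eq)
    qed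
  qed
qed

lemma maximal_measure_dirac:
  fixes X :: "'a::locally_convex_space set"
  assumes X: "compact X" "convex X" and x: "x \<in> ext X"
  shows "maximal_measure X (completion (dirac X x))"
  unfolding maximal_measure_def
proof (intro conjI ballI impI)
  have "x \<in> X" using x by (auto simp: ext_def extreme_point_of_def)
  then have "prob_space (dirac X x)"
    by (intro prob_space_return) (simp add: space_restrict_space)
  moreover have "emeasure (dirac X x) B = (SUP K\<in>{K. K \<subseteq> B \<and> compact K}. emeasure (dirac X x) K)"
    if B: "B \<in> sets (dirac X x)" for B
  proof (rule antisym)
    show "emeasure (dirac X x) B \<le> (SUP K\<in>{K. K \<subseteq> B \<and> compact K}. emeasure (dirac X x) K)"
    proof (cases "x \<in> B")
      case True
      \<comment> \<open>The compact set \<open>{x}\<close> attains the supremum in inner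
        regularity.\<close>
      then have "emeasure (dirac X x) B = emeasure (dirac X x) {x}"
        using B compact_subset_sets[of "{x}" X] \<open>x \<in> X\<close> by simp
      also have "\<dots> \<le> (SUP K\<in>{K. K \<subseteq> B \<and> compact K}. emeasure (dirac X x) K)"
        using True by (intro SUP_upper) auto
      finally show ?thesis .
    qed (use B in simp)
    show "(SUP K\<in>{K. K \<subseteq> B \<and> compact K}. emeasure (dirac X x) K) \<le> emeasure (dirac X x) B"
      using B by (intro SUP_least emeasure_mono) auto
  qed
  ultimately show "completion (dirac X x) \<in> M_1 X"
    unfolding M_1_def by (intro CollectI exI[of _ "dirac X x"]) auto
next
  fix \<nu> assume "\<nu> \<in> M_1 X" and le: "choquet_le X (completion (dirac X x)) \<nu>"
  then obtain \<nu>' where \<nu>': "\<nu> = completion \<nu>'" "prob_space \<nu>'"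
    "sets \<nu>' = sets (restrict_space borel X)"
    "\<And>B. B \<in> sets \<nu>' \<Longrightarrow> emeasure \<nu>' B = (SUP K\<in>{K. K \<subseteq> B \<and> compact K}. emeasure \<nu>' K)"
    unfolding M_1_def by blast
  then show "\<nu> = completion (dirac X x)"
    using choquet_above_dirac[OF X x \<nu>'(2,3,4)] le by simp
qed

text \<open>The Dirac measure at \<open>x\<close> is maximal and its null sets avoid
  \<open>x\<close>. This transfers identities of strong multipliers to \<open>ext X\<close>.\<close>

lemma maximal_AE_extreme_point:
  fixes X :: "'a::locally_convex_space set"
  assumes X: "compact X" "convex X" and x: "x \<in> ext X"
    and AE: "\<And>\<mu>. maximal_measure X \<mu> \<Longrightarrow> AE y in \<mu>. P y"
  shows "P x"
proof -
  have "AE y in dirac X x. P y"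
    using AE[OF maximal_measure_dirac[OF X x]] by (simp add: AE_completion_iff)
  then obtain N where N: "{y \<in> space (dirac X x). \<not> P y} \<subseteq> N" "N \<in> null_sets (dirac X x)"
    by (auto simp: eventually_ae_filter)
  then have "x \<notin> N" by (auto simp: null_sets_def split: split_indicator_asm)
  moreover have "x \<in> X" using x by (auto simp: ext_def extreme_point_of_def)
  ultimately show ?thesis using N(1) by (auto simp: space_restrict_space)
qed


section \<open>Multipliers\<close>

locale determined_function_space =
  fixes X :: "'a::locally_convex_space set" and H :: "('a \<Rightarrow> real) set"
  assumes compact_convex: "compact_convex_set X"
    and intermediate: "intermediate_function_space X H"
    and determined: "determined_by_extreme_points X H"
    and monotone_closed: "monotone_closure X H = H"
begin

lemma ext_subset: "x \<in> ext X \<Longrightarrow> x \<in> X"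
  by (auto simp: ext_def extreme_point_of_def)

lemma H_add: "f \<in> H \<Longrightarrow> g \<in> H \<Longrightarrow> (\<lambda>x\<in>X. f x + g x) \<in> H"
  and H_cmult: "f \<in> H \<Longrightarrow> (\<lambda>x\<in>X. c * f x) \<in> H"
  using intermediate by (auto simp: intermediate_function_space_def linear_subspace_on_def)

lemma H_diff: "f \<in> H \<Longrightarrow> g \<in> H \<Longrightarrow> (\<lambda>x\<in>X. f x - g x) \<in> H"
  using H_add[OF _ H_cmult[of g "-1"], of f] by (simp cong: restrict_cong)

lemma H_const: "(\<lambda>x\<in>X. c) \<in> H"
proof -
  have "(\<lambda>x\<in>X. c) \<in> A_c X"
    using compact_convex
    by (auto simp: A_c_def affine_fun_on_def compact_convex_set_def convex_alt algebra_simps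
        cong: continuous_on_cong)
  then show ?thesis using intermediate by (auto simp: intermediate_function_space_def)
qed

lemma H_bounded: "f \<in> H \<Longrightarrow> bounded (f ` X)"
  using intermediate by (auto simp: intermediate_function_space_def A_b_def)

text \<open>Were \<open>ext X\<close> empty, the junk value \<^term>\<open>Sup ({} :: real set)\<close> would bound all constants.\<close>

lemma ext_nonempty:
  assumes "x \<in> X"
  shows "ext X \<noteq> {}"
proof
  assume "ext X = {}"
  with determined assms H_const[of "Sup {} + 1"] show False
    by (force simp: determined_by_extreme_points_def)
qed

text \<open>The difference \<open>v - u\<close> lies in \<open>H\<close>, and determination by
  extreme points bounds it below on \<open>X\<close> by its infimum over
  \<open>ext X\<close>.\<close>

lemma le_on_X:
  assumes "u \<in> H" "v \<in> H" "\<And>y. y \<in> ext X \<Longrightarrow> u y \<le> v y" "x \<in> X"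
  shows "u x \<le> v x"
proof -
  let ?w = "\<lambda>x\<in>X. v x - u x"
  have "0 \<le> Inf (?w ` ext X)"
    using ext_nonempty[OF assms(4)] assms(3) by (intro cINF_greatest) (auto simp: ext_subset)
  also have "\<dots> \<le> ?w x"
    using determined H_diff[OF assms(2,1)] assms(4) unfolding determined_by_extreme_points_def by blast
  finally show ?thesis using assms(4) by simp
qed

lemma eq_on_X:
  assumes "u \<in> H" "v \<in> H" "\<And>y. y \<in> ext X \<Longrightarrow> u y = v y" "x \<in> X"
  shows "u x = v x"
  using le_on_X[OF assms(1,2) _ assms(4)] le_on_X[OF assms(2,1) _ assms(4)] assms(3)
  by (simp add: order_antisym)

text \<open>The limit is prescribed on \<open>ext X\<close> alone. Comparing successive terms, and
  each term with a constant, by \<open>le_on_X\<close> yields monotonicity and an upper bound on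
  \<open>X\<close>; the lower bound is that of \<open>s 0\<close>.\<close>

lemma H_incseq_limit:
  assumes s: "\<And>n. s n \<in> H" and inc: "\<And>x. x \<in> ext X \<Longrightarrow> incseq (\<lambda>n. s n x)"
    and lim: "\<And>x. x \<in> ext X \<Longrightarrow> (\<lambda>n. s n x) \<longlonglongrightarrow> g x" and bdd: "bounded (g ` ext X)"
  obtains f where "f \<in> H" "\<And>x. x \<in> X \<Longrightarrow> (\<lambda>n. s n x) \<longlonglongrightarrow> f x"
proof -
  obtain C where C: "\<And>x. x \<in> ext X \<Longrightarrow> \<bar>g x\<bar> \<le> C" using bdd by (auto simp: bounded_iff)
  obtain D where D: "\<And>x. x \<in> X \<Longrightarrow> \<bar>s 0 x\<bar> \<le> D" using H_bounded[OF s] by (fastforce simp: bounded_iff)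
  have inc_X: "incseq (\<lambda>n. s n x)" if "x \<in> X" for x
  proof (rule incseq_SucI)
    fix n show "s n x \<le> s (Suc n) x"
      by (rule le_on_X[OF s s _ that]) (rule incseq_SucD[OF inc])
  qed
  have upper: "s n x \<le> C" if x: "x \<in> X" for n x
  proof -
    have "s n x \<le> (\<lambda>x\<in>X. C) x"
    proof (rule le_on_X[OF s H_const _ x])
      fix y assume y: "y \<in> ext X"
      have "s n y \<le> g y" by (rule incseq_le[OF inc[OF y] lim[OF y]])
      then show "s n y \<le> (\<lambda>x\<in>X. C) y" using C[OF y] ext_subset[OF y] by simp
    qed
    with x show ?thesis by simp
  qed
  define f where "f = (\<lambda>x\<in>X. SUP n. s n x)"
  have lim_f: "(\<lambda>n. s n x) \<longlonglongrightarrow> f x" if "x \<in> X" for x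
    using LIMSEQ_incseq_SUP[OF bdd_aboveI2[of UNIV, OF upper[OF that]] inc_X[OF that]] that
    by (simp add: f_def)
  have "f \<in> monotone_closure X H"
  proof (rule monotone_closure.limit)
    show "s n \<in> monotone_closure X H" for n by (rule monotone_closure.base[OF s])
    show "\<forall>n. \<forall>x\<in>X. \<bar>s n x\<bar> \<le> max C D"
    proof (intro allI ballI)
      fix n x assume x: "x \<in> X"
      have "s 0 x \<le> s n x" using inc_X[OF x] by (simp add: incseq_def)
      with upper[OF x, of n] D[OF x] show "\<bar>s n x\<bar> \<le> max C D" by linarith
    qed
  qed (use inc_X lim_f in \<open>auto simp: f_def\<close>)
  with lim_f show ?thesis using monotone_closed that by auto
qed

end

text \<open>Multipliers and strong multipliers differ only in the sense of \<open>almost_all\<close> in which the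
  identity \<open>b = u a\<close> is required: on \<open>ext X\<close>, or almost everywhere for every maximal measure.\<close>

locale almost_all_multipliers = determined_function_space X H
  for X :: "'a::locally_convex_space set" and H :: "('a \<Rightarrow> real) set" +
  fixes almost_all :: "('a \<Rightarrow> bool) \<Rightarrow> bool"
  assumes almost_all_mono: "almost_all P \<Longrightarrow> (\<And>x. x \<in> X \<Longrightarrow> P x \<Longrightarrow> Q x) \<Longrightarrow> almost_all Q"
    and almost_all_countable: "(\<And>n::nat. almost_all (Ps n)) \<Longrightarrow> almost_all (\<lambda>x. \<forall>n. Ps n x)"
    and almost_all_ext: "almost_all P \<Longrightarrow> x \<in> ext X \<Longrightarrow> P x"
    and almost_all_True: "almost_all (\<lambda>_. True)"
begin

definition M :: "('a \<Rightarrow> real) set" where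
  "M = {u \<in> H. \<forall>a\<in>H. \<exists>b\<in>H. almost_all (\<lambda>x. b x = u x * a x)}"

lemma M_in_H: "u \<in> M \<Longrightarrow> u \<in> H"
  by (simp add: M_def)

lemma M_multiply:
  assumes "u \<in> M" "a \<in> H"
  obtains b where "b \<in> H" "almost_all (\<lambda>x. b x = u x * a x)"
  using assms by (auto simp: M_def)

lemma almost_all_conj:
  assumes "almost_all P" "almost_all Q"
  shows "almost_all (\<lambda>x. P x \<and> Q x)"
proof -
  \<comment> \<open>The pair is treated as the sequence \<open>P, Q, Q, ...\<close>.\<close>
  have "almost_all (\<lambda>x. \<forall>n::nat. (if n = 0 then P else Q) x)"
    by (rule almost_all_countable) (simp add: assms)
  then show ?thesis
  proof (rule almost_all_mono)
    fix x assume "\<forall>n::nat. (if n = 0 then P else Q) x"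
    from this[rule_format, of 0] this[rule_format, of 1] show "P x \<and> Q x" by simp_all
  qed
qed

lemma almost_all_always: "(\<And>x. x \<in> X \<Longrightarrow> P x) \<Longrightarrow> almost_all P"
  using almost_all_mono[OF almost_all_True] by blast

lemma M_const: "(\<lambda>x\<in>X. c) \<in> M"
  unfolding M_def
proof (intro CollectI conjI ballI H_const)
  fix a assume "a \<in> H"
  then show "\<exists>b\<in>H. almost_all (\<lambda>x. b x = (\<lambda>x\<in>X. c) x * a x)"
    by (intro bexI[OF _ H_cmult[of a c]] almost_all_always) auto
qed

lemma M_add:
  assumes u: "u \<in> M" and v: "v \<in> M"
  shows "(\<lambda>x\<in>X. u x + v x) \<in> M"
  unfolding M_def
proof (intro CollectI conjI ballI)
  show "(\<lambda>x\<in>X. u x + v x) \<in> H" by (intro H_add M_in_H u v)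
  fix a assume a: "a \<in> H"
  obtain b where b: "b \<in> H" "almost_all (\<lambda>x. b x = u x * a x)" by (rule M_multiply[OF u a])
  obtain c where c: "c \<in> H" "almost_all (\<lambda>x. c x = v x * a x)" by (rule M_multiply[OF v a])
  show "\<exists>d\<in>H. almost_all (\<lambda>x. d x = (\<lambda>x\<in>X. u x + v x) x * a x)"
    by (rule bexI[OF almost_all_mono[OF almost_all_conj[OF b(2) c(2)]] H_add[OF b(1) c(1)]])
      (simp add: distrib_right)
qed

lemma M_mult:
  assumes u: "u \<in> M" and v: "v \<in> M"
  obtains w where "w \<in> M" "\<And>x. x \<in> ext X \<Longrightarrow> w x = u x * v x"
proof -
  obtain w where w: "w \<in> H" "almost_all (\<lambda>x. w x = u x * v x)"
    by (rule M_multiply[OF u M_in_H[OF v]])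
  have "w \<in> M"
    unfolding M_def
  proof (intro CollectI conjI ballI)
    fix a assume a: "a \<in> H"
    obtain b where b: "b \<in> H" "almost_all (\<lambda>x. b x = v x * a x)" by (rule M_multiply[OF v a])
    \<comment> \<open>Associativity: \<open>w * a = u * (v * a)\<close>, so \<open>a\<close> is
      multiplied by \<open>v\<close> and then by \<open>u\<close>.\<close>
    obtain c where c: "c \<in> H" "almost_all (\<lambda>x. c x = u x * b x)" by (rule M_multiply[OF u b(1)])
    show "\<exists>d\<in>H. almost_all (\<lambda>x. d x = w x * a x)"
      by (rule bexI[OF almost_all_mono[OF almost_all_conj[OF w(2) almost_all_conj[OF b(2) c(2)]]] c(1)])
        simp
  qed (rule w(1))
  then show ?thesis using that almost_all_ext[OF w(2)] by blast
qed

lemma M_incseq_limit: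
  assumes s: "\<And>n. s n \<in> M" and inc: "\<And>x. x \<in> ext X \<Longrightarrow> incseq (\<lambda>n. s n x)"
    and lim: "\<And>x. x \<in> ext X \<Longrightarrow> (\<lambda>n. s n x) \<longlonglongrightarrow> g x" and bdd: "bounded (g ` ext X)"
  obtains f where "f \<in> M" "\<And>x. x \<in> X \<Longrightarrow> (\<lambda>n. s n x) \<longlonglongrightarrow> f x"
proof -
  obtain f where f: "f \<in> H" "\<And>x. x \<in> X \<Longrightarrow> (\<lambda>n. s n x) \<longlonglongrightarrow> f x"
    using H_incseq_limit[of s g, OF M_in_H[OF s] inc lim bdd] by blast
  obtain B where B: "\<And>x. x \<in> ext X \<Longrightarrow> \<bar>g x\<bar> \<le> B" using bdd by (auto simp: bounded_iff)
  have "f \<in> M"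
    unfolding M_def
  proof (intro CollectI conjI ballI)
    fix a assume a: "a \<in> H"
    obtain C where C: "\<And>x. x \<in> X \<Longrightarrow> \<bar>a x\<bar> \<le> C" using H_bounded[OF a] by (auto simp: bounded_iff)
    \<comment> \<open>The shift makes the factor nonnegative, so that the products
      \<open>s n * a'\<close> increase with \<open>n\<close> on \<open>ext X\<close>; the surplus
      \<open>C * f\<close> is subtracted at the end.\<close>
    define a' where "a' = (\<lambda>x\<in>X. a x + (\<lambda>x\<in>X. C) x)"
    have a': "a' \<in> H" unfolding a'_def by (intro H_add a H_const)
    have a'_eq: "a' x = a x + C" and a'_bounds: "0 \<le> a' x" "a' x \<le> 2 * C" if "x \<in> X" for x
      using C[OF that] that by (auto simp: a'_def)
    have "\<exists>b\<in>H. almost_all (\<lambda>x. b x = s n x * a' x)" for n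
      using M_multiply[OF s a'] by metis
    then obtain b where b: "\<And>n. b n \<in> H" "\<And>n. almost_all (\<lambda>x. b n x = s n x * a' x)" by metis
    have b_ext: "b n x = s n x * a' x" if "x \<in> ext X" for n x
      by (rule almost_all_ext[OF b(2) that])
    obtain c where c: "c \<in> H" "\<And>x. x \<in> X \<Longrightarrow> (\<lambda>n. b n x) \<longlonglongrightarrow> c x"
    proof (rule H_incseq_limit[of b "\<lambda>x. g x * a' x", OF b(1)])
      fix x assume x: "x \<in> ext X"
      show "incseq (\<lambda>n. b n x)"
        using incseq_SucD[OF inc[OF x]] a'_bounds[OF ext_subset[OF x]]
        by (intro incseq_SucI) (simp add: b_ext[OF x] mult_right_mono)
      show "(\<lambda>n. b n x) \<longlonglongrightarrow> g x * a' x"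
        unfolding b_ext[OF x] by (intro tendsto_mult_right lim x)
    next
      have "\<bar>g x * a' x\<bar> \<le> B * (2 * C)" if x: "x \<in> ext X" for x
        using B[OF x] a'_bounds[OF ext_subset[OF x]] unfolding abs_mult by (intro mult_mono) auto
      then show "bounded ((\<lambda>x. g x * a' x) ` ext X)" by (intro boundedI[of _ "B * (2 * C)"]) auto
    qed blast
    \<comment> \<open>Countably many exceptional sets combine, so outside one of them all product
      identities hold and pass to the limit.\<close>
    have "almost_all (\<lambda>x. (\<lambda>x\<in>X. c x - (\<lambda>x\<in>X. C * f x) x) x = f x * a x)"
      using almost_all_countable[OF b(2)]
    proof (rule almost_all_mono)
      fix x assume x: "x \<in> X" and eq: "\<forall>n. b n x = s n x * a' x"
      have "(\<lambda>n. b n x) \<longlonglongrightarrow> f x * a' x"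
        using tendsto_mult_right[OF f(2)[OF x]] eq by simp
      with c(2)[OF x] have "c x = f x * a' x" by (rule LIMSEQ_unique)
      then show "(\<lambda>x\<in>X. c x - (\<lambda>x\<in>X. C * f x) x) x = f x * a x"
        using x by (simp add: a'_eq algebra_simps)
    qed
    then show "\<exists>b\<in>H. almost_all (\<lambda>x. b x = f x * a x)"
      using H_diff[OF c(1) H_cmult[OF f(1)]] by blast
  qed (rule f(1))
  then show ?thesis using f(2) that by blast
qed

section \<open>The algebra of restrictions to \<open>ext X\<close> and its representing
  measures\<close>

sublocale bounded_monotone_algebra "ext X" "\<lambda>u. extends_to X u M"
proof
  fix f g assume "extends_to X f M" "\<And>x. x \<in> ext X \<Longrightarrow> g x = f x"
  then show "extends_to X g M" by (auto simp: extends_to_def)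
next
  fix c show "extends_to X (\<lambda>_. c) M"
    unfolding extends_to_def by (rule bexI[OF _ M_const[of c]]) (simp add: ext_subset)
next
  fix f g assume "extends_to X f M" "extends_to X g M"
  then obtain u v where uv: "u \<in> M" "v \<in> M" "\<forall>x\<in>ext X. u x = f x" "\<forall>x\<in>ext X. v x = g x"
    by (auto simp: extends_to_def)
  show "extends_to X (\<lambda>x. f x + g x) M"
    unfolding extends_to_def
    by (rule bexI[OF _ M_add[OF uv(1,2)]]) (simp add: ext_subset uv)
  obtain w where "w \<in> M" "\<And>x. x \<in> ext X \<Longrightarrow> w x = u x * v x" by (rule M_mult[OF uv(1,2)]) blast
  then show "extends_to X (\<lambda>x. f x * g x) M"
    unfolding extends_to_def using uv by auto
next
  fix f assume "extends_to X f M"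
  then obtain u where u: "u \<in> M" "\<forall>x\<in>ext X. u x = f x" by (auto simp: extends_to_def)
  then have "f ` ext X \<subseteq> u ` X" using ext_subset by (auto intro!: image_eqI)
  then show "bounded (f ` ext X)" by (rule bounded_subset[OF H_bounded[OF M_in_H[OF u(1)]]])
next
  fix s :: "nat \<Rightarrow> 'a \<Rightarrow> real" and f
  assume s: "\<And>n. extends_to X (s n) M" and inc: "\<And>x. x \<in> ext X \<Longrightarrow> incseq (\<lambda>n. s n x)"
    and lim: "\<And>x. x \<in> ext X \<Longrightarrow> (\<lambda>n. s n x) \<longlonglongrightarrow> f x" and bdd: "bounded (f ` ext X)"
  from s obtain m where m: "\<And>n. m n \<in> M" "\<And>n x. x \<in> ext X \<Longrightarrow> m n x = s n x"
    unfolding extends_to_def by metis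
  obtain h where h: "h \<in> M" "\<And>x. x \<in> X \<Longrightarrow> (\<lambda>n. m n x) \<longlonglongrightarrow> h x"
    using M_incseq_limit[of m f, OF m(1)] inc lim bdd m(2) by auto
  have "h x = f x" if "x \<in> ext X" for x
    using h(2)[OF ext_subset[OF that]] lim[OF that] by (simp add: m(2)[OF that] LIMSEQ_unique)
  with h(1) show "extends_to X f M" by (auto simp: extends_to_def)
qed

lemma indicator_sets_eq: "indicator_sets = indicator_system X M"
proof -
  have "(\<forall>x\<in>ext X. m x = indicator E x) \<longleftrightarrow> (\<forall>x\<in>E. m x = 1) \<and> (\<forall>x\<in>ext X - E. m x = 0)"
    if "E \<subseteq> ext X" for E and m :: "'a \<Rightarrow> real"
    using that by (auto simp: indicator_def)
  then show ?thesis
    unfolding indicator_sets_def unfolding indicator_system_def extends_to_def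
    by (intro Collect_cong conj_cong refl bex_cong)
qed

text \<open>For \<open>x\<close> in \<open>X\<close> the choice is immaterial: extensions of the
  same function agree on \<open>X\<close> by \<open>eq_on_X\<close>.\<close>

definition extension_value :: "'a \<Rightarrow> ('a \<Rightarrow> real) \<Rightarrow> real" where
  "extension_value x f = (SOME m. m \<in> M \<and> (\<forall>y\<in>ext X. m y = f y)) x"

lemma extension_value_eq:
  assumes "m \<in> M" "\<And>y. y \<in> ext X \<Longrightarrow> m y = f y" "x \<in> X"
  shows "extension_value x f = m x"
proof -
  let ?m = "SOME m. m \<in> M \<and> (\<forall>y\<in>ext X. m y = f y)"
  have m': "?m \<in> M \<and> (\<forall>y\<in>ext X. ?m y = f y)"
    by (rule someI[of _ m]) (use assms in blast)
  show ?thesis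
    unfolding extension_value_def
  proof (rule eq_on_X[OF M_in_H M_in_H[OF assms(1)] _ assms(3)])
    show "?m \<in> M" using m' by blast
    show "?m y = m y" if "y \<in> ext X" for y using m' assms(2)[OF that] that by simp
  qed
qed

lemma monotone_expectation_extension_value:
  assumes x: "x \<in> X"
  shows "monotone_expectation (ext X) (\<lambda>u. extends_to X u M) (extension_value x)"
proof
  fix f assume "extends_to X f M"
  then obtain u where u: "u \<in> M" "\<And>y. y \<in> ext X \<Longrightarrow> u y = f y" by (auto simp: extends_to_def)
  have val: "extension_value x f = u x" by (rule extension_value_eq[OF u x])
  show "extension_value x g = extension_value x f" if "\<And>y. y \<in> ext X \<Longrightarrow> g y = f y" for g
    unfolding val by (rule extension_value_eq[OF u(1) _ x]) (simp add: u that)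
  show "extension_value x (\<lambda>y. f y + g y) = extension_value x f + extension_value x g"
    if "extends_to X g M" for g
  proof -
    from that obtain v where v: "v \<in> M" "\<And>y. y \<in> ext X \<Longrightarrow> v y = g y" by (auto simp: extends_to_def)
    have "extension_value x (\<lambda>y. f y + g y) = (\<lambda>y\<in>X. u y + v y) x"
      by (rule extension_value_eq[OF M_add[OF u(1) v(1)] _ x]) (simp add: ext_subset u v)
    with x show ?thesis by (simp add: val extension_value_eq[OF v x])
  qed
  show "extension_value x (\<lambda>y. c * f y) = c * extension_value x f" for c
  proof -
    \<comment> \<open>The product is known only on \<open>ext X\<close>; \<open>eq_on_X\<close>
      identifies it with \<open>c * u\<close> at \<open>x\<close>.\<close>
    obtain w where w: "w \<in> M" "\<And>y. y \<in> ext X \<Longrightarrow> w y = (\<lambda>y\<in>X. c) y * u y"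
      by (rule M_mult[OF M_const u(1)]) blast
    have "extension_value x (\<lambda>y. c * f y) = w x"
      by (rule extension_value_eq[OF w(1) _ x]) (simp add: ext_subset u w)
    also have "\<dots> = (\<lambda>y\<in>X. c * u y) x"
      by (rule eq_on_X[OF M_in_H[OF w(1)] H_cmult[OF M_in_H[OF u(1)]] _ x]) (simp add: ext_subset w)
    finally show ?thesis using x by (simp add: val)
  qed
  show "0 \<le> extension_value x f" if "\<And>y. y \<in> ext X \<Longrightarrow> 0 \<le> f y"
    using le_on_X[OF H_const[of 0] M_in_H[OF u(1)] _ x] that x by (simp add: val u ext_subset)
next
  fix c show "extension_value x (\<lambda>_. c) = c"
    using extension_value_eq[OF M_const[of c], of "\<lambda>_. c" x] x by (simp add: ext_subset)
next
  fix s :: "nat \<Rightarrow> 'a \<Rightarrow> real" and f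
  assume s: "\<And>n. extends_to X (s n) M" and inc: "\<And>y. y \<in> ext X \<Longrightarrow> incseq (\<lambda>n. s n y)"
    and lim: "\<And>y. y \<in> ext X \<Longrightarrow> (\<lambda>n. s n y) \<longlonglongrightarrow> f y" and f: "extends_to X f M"
  from s obtain m where m: "\<And>n. m n \<in> M" "\<And>n y. y \<in> ext X \<Longrightarrow> m n y = s n y"
    unfolding extends_to_def by metis
  obtain h where h: "h \<in> M" "\<And>y. y \<in> X \<Longrightarrow> (\<lambda>n. m n y) \<longlonglongrightarrow> h y"
    using M_incseq_limit[of m f, OF m(1)] inc lim bounded[OF f] m(2) by auto
  have "h y = f y" if "y \<in> ext X" for y
    using h(2)[OF ext_subset[OF that]] lim[OF that] by (simp add: m(2)[OF that] LIMSEQ_unique)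
  then have "extension_value x f = h x" by (rule extension_value_eq[OF h(1) _ x])
  moreover have "extension_value x (s n) = m n x" for n
    by (rule extension_value_eq[OF m x])
  ultimately show "(\<lambda>n. extension_value x (s n)) \<longlonglongrightarrow> extension_value x f"
    using h(2)[OF x] by simp
qed

lemma ex1_representing_measure:
  assumes x: "x \<in> X"
  shows "\<exists>!\<mu>. prob_space \<mu> \<and> space \<mu> = ext X \<and> sets \<mu> = indicator_system X M \<and>
    (\<forall>m\<in>M. integrable \<mu> m \<and> m x = (\<integral>y. m y \<partial>\<mu>))"
proof -
  \<comment> \<open>A measure with space \<open>ext X\<close> does not distinguish a function from
    its extension, so testing extendable functions and testing multipliers coincide.\<close>
  have "(\<forall>f. extends_to X f M \<longrightarrow> integrable \<mu> f \<and> extension_value x f = integral\<^sup>L \<mu> f) \<longleftrightarrow>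
    (\<forall>m\<in>M. integrable \<mu> m \<and> m x = integral\<^sup>L \<mu> m)" if space: "space \<mu> = ext X" for \<mu>
  proof (intro iffI ballI allI impI)
    fix m assume "\<forall>f. extends_to X f M \<longrightarrow> integrable \<mu> f \<and> extension_value x f = integral\<^sup>L \<mu> f"
      and m: "m \<in> M"
    moreover have "extends_to X m M" using m by (auto simp: extends_to_def)
    moreover have "extension_value x m = m x" by (rule extension_value_eq[OF m refl x])
    ultimately show "integrable \<mu> m \<and> m x = integral\<^sup>L \<mu> m" by auto
  next
    fix f assume M: "\<forall>m\<in>M. integrable \<mu> m \<and> m x = integral\<^sup>L \<mu> m" and "extends_to X f M"
    then obtain m where m: "m \<in> M" "\<And>y. y \<in> ext X \<Longrightarrow> m y = f y" by (auto simp: extends_to_def)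
    have "integrable \<mu> m \<longleftrightarrow> integrable \<mu> f"
      by (rule Bochner_Integration.integrable_cong) (simp_all add: space m(2))
    moreover have "integral\<^sup>L \<mu> m = integral\<^sup>L \<mu> f"
      by (rule Bochner_Integration.integral_cong) (simp_all add: space m(2))
    ultimately show "integrable \<mu> f \<and> extension_value x f = integral\<^sup>L \<mu> f"
      using M m(1) by (simp add: extension_value_eq[OF m x])
  qed
  then have "(\<lambda>\<mu>. prob_space \<mu> \<and> space \<mu> = ext X \<and> sets \<mu> = indicator_sets \<and>
      (\<forall>f. extends_to X f M \<longrightarrow> integrable \<mu> f \<and> extension_value x f = integral\<^sup>L \<mu> f)) =
    (\<lambda>\<mu>. prob_space \<mu> \<and> space \<mu> = ext X \<and> sets \<mu> = indicator_system X M \<and>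
      (\<forall>m\<in>M. integrable \<mu> m \<and> m x = integral\<^sup>L \<mu> m))"
    unfolding indicator_sets_eq by (intro ext) blast
  with monotone_expectation.unique_representing_measure[OF monotone_expectation_extension_value[OF x]]
  show ?thesis by simp
qed

end

section \<open>Specialisation to multipliers and strong multipliers\<close>

lemma space_M_1: "\<mu> \<in> M_1 X \<Longrightarrow> space \<mu> = X"
proof -
  assume "\<mu> \<in> M_1 X"
  then obtain \<nu> where \<nu>: "\<mu> = completion \<nu>" "sets \<nu> = sets (restrict_space borel X)"
    unfolding M_1_def by blast
  then show ?thesis using sets_eq_imp_space_eq[OF \<nu>(2)] by (simp add: space_restrict_space)
qed

theorem theorem8p4:
  fixes X :: "'a::locally_convex_space set" and H :: "('a \<Rightarrow> real) set"
  assumes "compact_convex_set X"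
    and "intermediate_function_space X H"
    and "determined_by_extreme_points X H"
    and "monotone_closure X H = H"
  shows "(sigma_algebra (ext X) (mult_algebra X H) \<and>
          sigma_algebra (ext X) (strong_mult_algebra X H)) \<and>
         (\<forall>u :: 'a \<Rightarrow> real. bounded (u ` ext X) \<longrightarrow>
            (extends_to X u (multipliers X H) \<longleftrightarrow>
               u \<in> borel_measurable (sigma (ext X) (mult_algebra X H))) \<and>
            (extends_to X u (strong_multipliers X H) \<longleftrightarrow>
               u \<in> borel_measurable (sigma (ext X) (strong_mult_algebra X H)))) \<and>
         (\<forall>x\<in>X. \<exists>!\<mu>. prob_space \<mu> \<and> space \<mu> = ext X \<and> sets \<mu> = mult_algebra X H \<and>
            (\<forall>m\<in>multipliers X H. integrable \<mu> m \<and> m x = (\<integral>y. m y \<partial>\<mu>)))"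
proof -
  interpret determined_function_space X H by unfold_locales fact+
  have X: "compact X" "convex X" using assms(1) by (auto simp: compact_convex_set_def)
  interpret m: almost_all_multipliers X H "\<lambda>P. \<forall>x\<in>ext X. P x"
    by unfold_locales (auto simp: ext_subset)
  interpret s: almost_all_multipliers X H "\<lambda>P. \<forall>\<mu>. maximal_measure X \<mu> \<longrightarrow> (AE x in \<mu>. P x)"
  proof
    fix P Q assume P: "\<forall>\<mu>. maximal_measure X \<mu> \<longrightarrow> (AE x in \<mu>. P x)"
      and PQ: "\<And>x. x \<in> X \<Longrightarrow> P x \<Longrightarrow> Q x"
    show "\<forall>\<mu>. maximal_measure X \<mu> \<longrightarrow> (AE x in \<mu>. Q x)"
    proof (intro allI impI)
      fix \<mu> assume \<mu>: "maximal_measure X \<mu>"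
      then have "space \<mu> = X" by (simp add: maximal_measure_def space_M_1)
      then have "AE x in \<mu>. P x \<longrightarrow> Q x" using PQ by (intro AE_I2) simp
      with P \<mu> show "AE x in \<mu>. Q x" by auto
    qed
  next
    \<comment> \<open>Here maximality of the Dirac measures at extreme points enters.\<close>
    fix P x assume "\<forall>\<mu>. maximal_measure X \<mu> \<longrightarrow> (AE x in \<mu>. P x)" "x \<in> ext X"
    then show "P x" using maximal_AE_extreme_point[OF X] by blast
  qed (auto simp: AE_all_countable)
  have m: "m.M = multipliers X H" by (simp add: m.M_def multipliers_def)
  have s: "s.M = strong_multipliers X H" by (simp add: s.M_def strong_multipliers_def)
  note facts = m.sigma_algebra_indicator_sets s.sigma_algebra_indicator_sets
    m.iff_measurable s.iff_measurable m.ex1_representing_measure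
  note facts = facts[unfolded m.indicator_sets_eq s.indicator_sets_eq, unfolded m s]
  show ?thesis
  proof (intro conjI allI impI ballI)
    fix u :: "'a \<Rightarrow> real" assume bdd: "bounded (u ` ext X)"
    show "extends_to X u (multipliers X H) \<longleftrightarrow> u \<in> borel_measurable (sigma (ext X) (mult_algebra X H))"
      unfolding facts(3)[of u] using bdd by blast
    show "extends_to X u (strong_multipliers X H) \<longleftrightarrow>
        u \<in> borel_measurable (sigma (ext X) (strong_mult_algebra X H))"
      unfolding facts(4)[of u] using bdd by blast
  qed (rule facts(1) facts(2) facts(5), assumption?)+
qed

end
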